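(* Let $\bar\kappa$ be a fixed positive integer. Let $\bar f\in\mathbb{R}_{++}$, $d\in[0,\bar f)$, and $\bar f_j=\kappa_j\bar f$ with $\kappa_j\in\{1,\dots,\bar\kappa\}$ for $j\in\{1,\dots,n\}$. Consider the set $$\mathcal{S}=\Big\{(x,f)\in\{0,1\}^n\times\mathbb{R}^{n+1}:\ \sum_{j=0}^n f_j=d,\ \ \underline f_j x_j\le f_j\le \bar f_j x_j,\ j\in\{0,1,\dots,n\}\Big\},$$ where $\underline f_j=-\bar f_j$ for $j\in\{1,\dots,n\}$, $x_0:=1$ and $\underline f_0=\bar f_0=0$. Then there exists an algorithm for optimizing a linear function over $\mathcal{S}$ whose running time is polynomial in the size of the input.
   Context: Coordinates: $x=(x_1,\dots,x_n)$ and $f=(f_0,f_1,\dots,f_n)$; $x_0$ is the constant $1$, so here the $j=0$ constraint forces $f_0=0$. The input consists of $n$, $\kappa_1,\dots,\kappa_n$, $\bar f$, $d$ and the coefficients of the linear objective function in the variables $(x,f)$; its size is measured in the usual bit-encoding sense. The integer $\bar\kappa$ is a fixed constant, not part of the input. *)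

theory Defs
  imports "HOL-Computational_Algebra.Polynomial" "HOL-Library.Log_Nat" "HOL-Library.FuncSet"
begin

text \<open>
  The machine is an integer random access machine with structured control flow.  Its memory
  consists of named arrays of integers, indexed by integers; a program mentions finitely many
  names, and a scalar variable is an array used at one index.  Time is measured by the logarithmic
  cost criterion: each constant, each memory access and each arithmetic operation is charged the
  bit length of all integers it handles, addresses included.  Hence no integer arising in a
  computation has more bits than the time spent, and simulation by Turing machines and conversely
  is polynomial in input size plus running time.
\<close>

type_synonym vname = string
type_synonym store = "vname \<Rightarrow> int \<Rightarrow> int"

datatype aexp =
    Const int
  | Read vname aexp
  | Add aexp aexp
  | Sub aexp aexp
  | Mul aexp aexp

datatype bexp =
    Less aexp aexp
  | Eq aexp aexp
  | Neg bexp
  | Conj bexp bexp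

datatype com =
    Skip
  | Write vname aexp aexp
  | Seq com com
  | Cond bexp com com
  | While bexp com

text \<open>One bit for the sign, then the binary digits of the absolute value (none for zero).\<close>

definition bits :: "int \<Rightarrow> nat" where
  "bits z = 1 + floorlog 2 (nat \<bar>z\<bar>)"

fun aval :: "aexp \<Rightarrow> store \<Rightarrow> int" where
  "aval (Const z) s = z"
| "aval (Read v a) s = s v (aval a s)"
| "aval (Add a b) s = aval a s + aval b s"
| "aval (Sub a b) s = aval a s - aval b s"
| "aval (Mul a b) s = aval a s * aval b s"

text \<open>The cost of an expression includes the bit length of its value, so that the operands of
  an operation, and the address of a memory access, are paid for by the recursive calls.\<close>

fun acost :: "aexp \<Rightarrow> store \<Rightarrow> nat" where
  "acost (Const z) s = bits z"
| "acost (Read v a) s = acost a s + bits (aval (Read v a) s)"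
| "acost (Add a b) s = acost a s + acost b s + bits (aval (Add a b) s)"
| "acost (Sub a b) s = acost a s + acost b s + bits (aval (Sub a b) s)"
| "acost (Mul a b) s = acost a s + acost b s + bits (aval (Mul a b) s)"

fun bval :: "bexp \<Rightarrow> store \<Rightarrow> bool" where
  "bval (Less a b) s \<longleftrightarrow> aval a s < aval b s"
| "bval (Eq a b) s \<longleftrightarrow> aval a s = aval b s"
| "bval (Neg b) s \<longleftrightarrow> \<not> bval b s"
| "bval (Conj b c) s \<longleftrightarrow> bval b s \<and> bval c s"

fun bcost :: "bexp \<Rightarrow> store \<Rightarrow> nat" where
  "bcost (Less a b) s = acost a s + acost b s + 1"
| "bcost (Eq a b) s = acost a s + acost b s + 1"
| "bcost (Neg b) s = bcost b s + 1"
| "bcost (Conj b c) s = bcost b s + bcost c s + 1"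

definition update :: "store \<Rightarrow> vname \<Rightarrow> int \<Rightarrow> int \<Rightarrow> store" where
  "update s v i z = s(v := (s v)(i := z))"

text \<open>\<open>exec c s t s'\<close>: started in store \<open>s\<close>, the program \<open>c\<close> halts in store \<open>s'\<close> after time \<open>t\<close>.\<close>

inductive exec :: "com \<Rightarrow> store \<Rightarrow> nat \<Rightarrow> store \<Rightarrow> bool" where
  Skip: "exec Skip s 1 s"
| Write: "exec (Write v a b) s (acost a s + acost b s) (update s v (aval a s) (aval b s))"
| Seq: "exec c1 s t1 s' \<Longrightarrow> exec c2 s' t2 s'' \<Longrightarrow> exec (Seq c1 c2) s (t1 + t2) s''"
| CondTrue: "bval b s \<Longrightarrow> exec c1 s t s' \<Longrightarrow> exec (Cond b c1 c2) s (bcost b s + t) s'"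
| CondFalse: "\<not> bval b s \<Longrightarrow> exec c2 s t s' \<Longrightarrow> exec (Cond b c1 c2) s (bcost b s + t) s'"
| WhileFalse: "\<not> bval b s \<Longrightarrow> exec (While b c) s (bcost b s) s"
| WhileTrue: "bval b s \<Longrightarrow> exec c s t1 s' \<Longrightarrow> exec (While b c) s' t2 s'' \<Longrightarrow>
    exec (While b c) s (bcost b s + t1 + t2) s''"

lemma exec_deterministic:
  "exec c s t s' \<Longrightarrow> exec c s u s'' \<Longrightarrow> u = t \<and> s'' = s'"
proof (induction arbitrary: u s'' rule: exec.induct)
  case (Seq c1 s t1 s' c2 t2 s3)
  from Seq.prems show ?case by cases (use Seq.IH in blast)
next
  case (WhileTrue b s c t1 s' t2 s3)
  from WhileTrue.prems show ?case
    by cases (use WhileTrue.IH WhileTrue.hyps in blast)+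
qed (erule exec.cases; force)+

text \<open>Input and output are finite integer sequences, stored in positions \<open>1, \<dots>, length\<close> of the
  arrays \<open>in\<close> and \<open>out\<close>, with the length in position \<open>0\<close>.\<close>

definition initial_store :: "int list \<Rightarrow> store" where
  "initial_store xs = (\<lambda>v i.
     if v = ''in'' \<and> 0 \<le> i \<and> i \<le> int (length xs) then (int (length xs) # xs) ! nat i else 0)"

definition output_of :: "store \<Rightarrow> int list" where
  "output_of s = map (\<lambda>i. s ''out'' (int i)) [1..<Suc (nat (s ''out'' 0))]"

definition bit_size :: "int list \<Rightarrow> nat" where
  "bit_size xs = sum_list (map bits xs)"

text \<open>A computational problem is given by its instances, their encoding, and the relation between
  an instance and the outputs that are acceptable for it.\<close>

definition poly_time_solvable :: "'i set \<Rightarrow> ('i \<Rightarrow> int list) \<Rightarrow> ('i \<Rightarrow> int list \<Rightarrow> bool) \<Rightarrow> bool" where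
  "poly_time_solvable instances encode correct \<longleftrightarrow>
     (\<exists>(prog :: com) (p :: nat poly). \<forall>I \<in> instances. \<exists>t s.
        exec prog (initial_store (encode I)) t s \<and>
        t \<le> poly p (bit_size (encode I)) \<and>
        correct I (output_of s))"

definition upper_cap :: "(nat \<Rightarrow> nat) \<Rightarrow> real \<Rightarrow> nat \<Rightarrow> real" where
  "upper_cap \<kappa> fb j = (if j = 0 then 0 else real (\<kappa> j) * fb)"

definition lower_cap :: "(nat \<Rightarrow> nat) \<Rightarrow> real \<Rightarrow> nat \<Rightarrow> real" where
  "lower_cap \<kappa> fb j = (if j = 0 then 0 else - upper_cap \<kappa> fb j)"

text \<open>Vectors are extensional functions on their index sets, \<open>{1..n}\<close> for \<open>x\<close> and \<open>{0..n}\<close>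
  for \<open>f\<close>; \<open>x(0 := 1)\<close> adds the constant \<open>x\<^sub>0 = 1\<close>.\<close>

definition feasible_set ::
    "nat \<Rightarrow> (nat \<Rightarrow> nat) \<Rightarrow> real \<Rightarrow> real \<Rightarrow> ((nat \<Rightarrow> real) \<times> (nat \<Rightarrow> real)) set" where
  "feasible_set n \<kappa> fb d =
     {(x, f). x \<in> {1..n} \<rightarrow>\<^sub>E {0, 1} \<and> f \<in> {0..n} \<rightarrow>\<^sub>E UNIV \<and>
        (\<Sum>j=0..n. f j) = d \<and>
        (\<forall>j\<in>{0..n}. lower_cap \<kappa> fb j * (x(0 := 1)) j \<le> f j \<and>
                     f j \<le> upper_cap \<kappa> fb j * (x(0 := 1)) j)}"

definition linear_objective ::
    "nat \<Rightarrow> (nat \<Rightarrow> real) \<Rightarrow> (nat \<Rightarrow> real) \<Rightarrow> (nat \<Rightarrow> real) \<times> (nat \<Rightarrow> real) \<Rightarrow> real" where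
  "linear_objective n a b = (\<lambda>(x, f). (\<Sum>j=1..n. a j * x j) + (\<Sum>j=0..n. b j * f j))"

text \<open>Numerical data of an instance is rational, so that it has a bit encoding.  The functions are
  only relevant on \<open>{1..n}\<close> (\<open>kappa\<close>, \<open>coeff_x\<close>) and \<open>{0..n}\<close> (\<open>coeff_f\<close>), where \<open>n = dim\<close>.\<close>

record flow_instance =
  dim :: nat
  kappa :: "nat \<Rightarrow> nat"
  fbar :: rat
  demand :: rat
  coeff_x :: "nat \<Rightarrow> rat"
  coeff_f :: "nat \<Rightarrow> rat"

definition flow_instances :: "nat \<Rightarrow> flow_instance set" where
  "flow_instances kbar =
     {I. fbar I > 0 \<and> demand I \<in> {0..<fbar I} \<and> (\<forall>j\<in>{1..dim I}. kappa I j \<in> {1..kbar})}"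

definition instance_feasible :: "flow_instance \<Rightarrow> ((nat \<Rightarrow> real) \<times> (nat \<Rightarrow> real)) set" where
  "instance_feasible I =
     feasible_set (dim I) (kappa I) (of_rat (fbar I)) (of_rat (demand I))"

definition instance_objective :: "flow_instance \<Rightarrow> (nat \<Rightarrow> real) \<times> (nat \<Rightarrow> real) \<Rightarrow> real" where
  "instance_objective I =
     linear_objective (dim I) (\<lambda>j. of_rat (coeff_x I j)) (\<lambda>j. of_rat (coeff_f I j))"

text \<open>A rational number is encoded by its numerator and denominator in lowest terms.\<close>

definition encode_rat :: "rat \<Rightarrow> int list" where
  "encode_rat r = [fst (quotient_of r), snd (quotient_of r)]"

definition encode_instance :: "flow_instance \<Rightarrow> int list" where
  "encode_instance I =
     [int (dim I)] @ map (\<lambda>j. int (kappa I j)) [1..<Suc (dim I)] @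
     encode_rat (fbar I) @ encode_rat (demand I) @
     concat (map (\<lambda>j. encode_rat (coeff_x I j)) [1..<Suc (dim I)]) @
     concat (map (\<lambda>j. encode_rat (coeff_f I j)) [0..<Suc (dim I)])"

datatype sense = Minimize | Maximize

definition is_optimal :: "sense \<Rightarrow> ('a \<Rightarrow> real) \<Rightarrow> 'a set \<Rightarrow> 'a \<Rightarrow> bool" where
  "is_optimal sense g S z =
     (case sense of
        Minimize \<Rightarrow> is_arg_min g (\<lambda>y. y \<in> S) z
      | Maximize \<Rightarrow> is_arg_max g (\<lambda>y. y \<in> S) z)"

text \<open>If there is no feasible point (which happens only for \<open>n = 0\<close> and nonzero demand), the output
  is \<open>[0]\<close>.  Otherwise it is \<open>1\<close> followed by an optimal solution: the entries of \<open>x\<close>, then those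
  of \<open>f\<close> as fractions, not necessarily in lowest terms.\<close>

definition optimal_output :: "sense \<Rightarrow> flow_instance \<Rightarrow> int list \<Rightarrow> bool" where
  "optimal_output sense I ys \<longleftrightarrow>
     (if instance_feasible I = {} then ys = [0]
      else \<exists>x p q :: nat \<Rightarrow> int.
        ys = [1] @ map x [1..<Suc (dim I)] @ concat (map (\<lambda>j. [p j, q j]) [0..<Suc (dim I)]) \<and>
        (\<forall>j\<in>{0..dim I}. q j > 0) \<and>
        is_optimal sense (instance_objective I) (instance_feasible I)
          (\<lambda>j\<in>{1..dim I}. real_of_int (x j),
           \<lambda>j\<in>{0..dim I}. real_of_int (p j) / real_of_int (q j)))"

end

theory Submission
  imports Defs
begin

text \<open>
  Fix which arcs are open.  What remains is a linear program over a box with one equality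
  constraint, and shifting flow between two arcs that are both strictly inside their intervals
  never hurts in one of the two directions.  So some optimal flow has at most one arc off its
  bounds (\<open>exchange_to_bounds\<close>).  The bounds are integer multiples of \<open>fbar\<close>; since
  \<open>0 \<le> demand < fbar\<close>, the exceptional arc carries \<open>c * fbar + demand\<close> for an integer \<open>c\<close>, and
  there is exactly one such arc unless the demand is zero (\<open>integral_flow\<close>).  Hence each arc has
  only \<open>O(kbar)\<close> relevant choices \<open>(x, e, c)\<close>, namely \<open>x\<close> open or closed and flow
  \<open>c * fbar + e * demand\<close> with \<open>e \<le> x\<close>, and the flow constraint says that the \<open>c\<close> sum to zero
  and the \<open>e\<close> sum to one (to zero for zero demand).

  Both sums are merged into one by giving a choice the weight \<open>H * e + c\<close> with \<open>H\<close> larger than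
  any sum of the \<open>c\<close> (\<open>weight_sum\<close>).  As \<open>kbar\<close> is constant, partial sums of weights take only
  polynomially many values, so a dynamic program over (number of arcs treated, partial sum) finds
  a cheapest selection with the prescribed total weight (\<open>table_optimal\<close>).  The machine has no
  division, so the costs in layer \<open>j\<close> are kept over the common denominator that is the product of
  the denominators of the first \<open>j\<close> arcs; it has polynomially many bits (\<open>reached_bound\<close>).

  The running time is separated into a number of steps, counted by a Hoare logic, and a uniform
  bound on the bit length of all numbers in memory, which limits the cost of a single step
  (\<open>triple\<close>).
\<close>

section \<open>Optimal flows are integral up to one arc\<close>

text \<open>A flow inside a box can be pushed to the bounds: as long as two arcs \<open>p\<close> and \<open>q\<close> with
  \<open>b p \<le> b q\<close> are strictly inside, moving flow from \<open>q\<close> to \<open>p\<close> keeps the sum, does not increase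
  the cost, and can be continued until one of them hits a bound.\<close>

lemma exchange_to_bounds:
  fixes f l u b :: "'a \<Rightarrow> real"
  assumes "finite A" and "\<And>j. j \<in> A \<Longrightarrow> l j \<le> f j \<and> f j \<le> u j"
  shows "\<exists>g. (\<forall>j\<in>A. l j \<le> g j \<and> g j \<le> u j) \<and> sum g A = sum f A \<and>
    (\<Sum>j\<in>A. b j * g j) \<le> (\<Sum>j\<in>A. b j * f j) \<and>
    (\<forall>i\<in>A. \<forall>j\<in>A. l i < g i \<and> g i < u i \<and> l j < g j \<and> g j < u j \<longrightarrow> i = j)"
  using assms(2)
proof (induction "card {j\<in>A. l j < f j \<and> f j < u j}" arbitrary: f rule: less_induct)
  case less
  show ?case
  proof (cases "\<forall>i\<in>A. \<forall>j\<in>A. l i < f i \<and> f i < u i \<and> l j < f j \<and> f j < u j \<longrightarrow> i = j")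
    case True
    then show ?thesis using less.prems by blast
  next
    case False
    then obtain p q where pq: "p \<in> A" "q \<in> A" "p \<noteq> q" "l p < f p" "f p < u p" "l q < f q" "f q < u q"
      "b p \<le> b q"
      by (metis linear)
    define \<epsilon> where "\<epsilon> = min (u p - f p) (f q - l q)"
    define g where "g = f(p := f p + \<epsilon>, q := f q - \<epsilon>)"
    have e: "\<epsilon> > 0" "f p + \<epsilon> \<le> u p" "l q \<le> f q - \<epsilon>" "f p + \<epsilon> = u p \<or> f q - \<epsilon> = l q"
      unfolding \<epsilon>_def min_def using pq by auto
    have split: "sum h A = h p + h q + sum h (A - {p, q})" for h :: "'a \<Rightarrow> real"
      using pq \<open>finite A\<close> sum.subset_diff[of "{p, q}" A h] by simp
    have same: "g j = f j" if "j \<in> A - {p, q}" for j using that by (simp add: g_def)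
    have gpq: "g p = f p + \<epsilon>" "g q = f q - \<epsilon>" using pq(3) by (simp_all add: g_def)
    have "sum g (A - {p, q}) = sum f (A - {p, q})"
      "(\<Sum>j\<in>A - {p, q}. b j * g j) = (\<Sum>j\<in>A - {p, q}. b j * f j)"
      by (rule sum.cong; simp add: same)+
    moreover have "b p * \<epsilon> \<le> b q * \<epsilon>" using pq(8) e(1) by simp
    ultimately have sums: "sum g A = sum f A" "(\<Sum>j\<in>A. b j * g j) \<le> (\<Sum>j\<in>A. b j * f j)"
      using split[of g] split[of f] split[of "\<lambda>j. b j * g j"] split[of "\<lambda>j. b j * f j"] gpq
      by (simp_all add: ring_distribs)
    have bounds: "l j \<le> g j \<and> g j \<le> u j" if "j \<in> A" for j
      using less.prems[OF that] e pq by (auto simp: g_def)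
    have "{j\<in>A. l j < g j \<and> g j < u j} \<subseteq> {j\<in>A. l j < f j \<and> f j < u j}"
    proof
      fix j assume j: "j \<in> {j\<in>A. l j < g j \<and> g j < u j}"
      show "j \<in> {j\<in>A. l j < f j \<and> f j < u j}"
      proof (cases "j = p \<or> j = q")
        case True
        then show ?thesis using pq by blast
      next
        case False
        then show ?thesis using j same[of j] by auto
      qed
    qed
    moreover have "p \<notin> {j\<in>A. l j < g j \<and> g j < u j} \<or> q \<notin> {j\<in>A. l j < g j \<and> g j < u j}"
      using e(4) by (auto simp: gpq)
    ultimately have "{j\<in>A. l j < g j \<and> g j < u j} \<subset> {j\<in>A. l j < f j \<and> f j < u j}"
      using pq by blast
    then have "card {j\<in>A. l j < g j \<and> g j < u j} < card {j\<in>A. l j < f j \<and> f j < u j}"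
      using \<open>finite A\<close> by (intro psubset_card_mono) auto
    from less.hyps[OF this bounds] obtain h where
      h: "\<forall>j\<in>A. l j \<le> h j \<and> h j \<le> u j" "sum h A = sum g A" "(\<Sum>j\<in>A. b j * h j) \<le> (\<Sum>j\<in>A. b j * g j)"
        "\<forall>i\<in>A. \<forall>j\<in>A. l i < h i \<and> h i < u i \<and> l j < h j \<and> h j < u j \<longrightarrow> i = j"
      by blast
    have "sum h A = sum f A" "(\<Sum>j\<in>A. b j * h j) \<le> (\<Sum>j\<in>A. b j * f j)"
      using h(2,3) sums by linarith+
    with h(1,4) show ?thesis by (intro exI[of _ h] conjI)
  qed
qed

text \<open>With bounds that are multiples of \<open>F\<close>, the arc that remains inside its interval carries the
  demand modulo \<open>F\<close>.  For \<open>e j = 1\<close> the constraints on \<open>c j\<close> express the capacity exactly: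
  \<open>c j * F + d \<le> K j * F\<close> forces \<open>c j \<le> K j - 1\<close> because \<open>0 < d\<close>, and
  \<open>- (K j * F) \<le> c j * F + d\<close> forces \<open>- K j \<le> c j\<close> because \<open>d < F\<close>.\<close>

lemma integral_flow:
  fixes K :: "'a \<Rightarrow> int" and F d :: real and f b :: "'a \<Rightarrow> real"
  assumes A: "finite A" and F: "0 < F" and d: "0 \<le> d" "d < F"
    and cap: "\<And>j. j \<in> A \<Longrightarrow> \<bar>f j\<bar> \<le> of_int (K j) * F" and sum: "sum f A = d"
  shows "\<exists>c e :: 'a \<Rightarrow> int. (\<forall>j\<in>A. 0 \<le> e j \<and> e j \<le> 1 \<and> - K j \<le> c j \<and> c j \<le> K j - e j) \<and>
    sum c A = 0 \<and> sum e A = (if d = 0 then 0 else 1) \<and>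
    (\<Sum>j\<in>A. b j * (of_int (c j) * F + of_int (e j) * d)) \<le> (\<Sum>j\<in>A. b j * f j)"
proof -
  obtain g where g: "\<And>j. j \<in> A \<Longrightarrow> - (of_int (K j) * F) \<le> g j \<and> g j \<le> of_int (K j) * F"
    and gsum: "sum g A = d" and gcost: "(\<Sum>j\<in>A. b j * g j) \<le> (\<Sum>j\<in>A. b j * f j)"
    and uniq: "\<And>i j. i \<in> A \<Longrightarrow> j \<in> A \<Longrightarrow> - (of_int (K i) * F) < g i \<Longrightarrow> g i < of_int (K i) * F \<Longrightarrow>
       - (of_int (K j) * F) < g j \<Longrightarrow> g j < of_int (K j) * F \<Longrightarrow> i = j"
  proof -
    have "- (of_int (K j) * F) \<le> f j \<and> f j \<le> of_int (K j) * F" if "j \<in> A" for j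
      using cap[OF that] by linarith
    from exchange_to_bounds[of A "\<lambda>j. - (of_int (K j) * F)" f "\<lambda>j. of_int (K j) * F" b, OF A this]
    show ?thesis using that sum by blast
  qed
  \<comment> \<open>the number of units of \<open>F\<close> on an arc that sits at one of its bounds\<close>
  define m where "m j = (if g j = of_int (K j) * F then K j else - K j)" for j
  have m: "g j = of_int (m j) * F" if "j \<in> A" "\<not> (- (of_int (K j) * F) < g j \<and> g j < of_int (K j) * F)" for j
    using g[OF that(1)] that(2) by (auto simp: m_def)
  have mK: "\<bar>m j\<bar> \<le> K j" if "j \<in> A" for j
  proof -
    have "0 \<le> of_int (K j) * F" using cap[OF that] by linarith
    then show ?thesis using F by (auto simp: m_def zero_le_mult_iff)
  qed
  show ?thesis
  proof (cases "\<exists>r\<in>A. - (of_int (K r) * F) < g r \<and> g r < of_int (K r) * F")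
    case False
    have gm: "g j = of_int (m j) * F" if "j \<in> A" for j using m that False by blast
    have "d = of_int (sum m A) * F"
      using gsum gm by (simp add: sum_distrib_right)
    \<comment> \<open>a multiple of \<open>F\<close> in \<open>[0, F)\<close> vanishes\<close>
    then have "0 \<le> of_int (sum m A) * F" "of_int (sum m A) * F < 1 * F" using d by auto
    then have "0 \<le> sum m A" "sum m A < 1" using F
      by (auto simp: zero_le_mult_iff simp del: of_int_sum)
    then have "sum m A = 0" by simp
    then have "d = 0" using \<open>d = of_int (sum m A) * F\<close> by (simp del: of_int_sum)
    have "(\<Sum>j\<in>A. b j * (of_int (m j) * F)) = (\<Sum>j\<in>A. b j * g j)" using gm by simp
    then have "(\<Sum>j\<in>A. b j * (of_int (m j) * F + of_int 0 * d)) \<le> (\<Sum>j\<in>A. b j * f j)"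
      using gcost by simp
    moreover have "- K j \<le> m j \<and> m j \<le> K j - 0" if "j \<in> A" for j
      using mK[OF that] by linarith
    moreover have "sum (\<lambda>_. 0) A = (if d = 0 then 0 else 1 :: int)" using \<open>d = 0\<close> by simp
    ultimately show ?thesis
      using \<open>sum m A = 0\<close> by (intro exI[of _ m] exI[of _ "\<lambda>_. 0"]) simp
  next
    case True
    then obtain r where r: "r \<in> A" "- (of_int (K r) * F) < g r" "g r < of_int (K r) * F" by blast
    define M where "M = sum m (A - {r})"
    define c where "c = m(r := - M)"
    define e where "e = (\<lambda>j. if j = r \<and> d \<noteq> 0 then 1 else 0 :: int)"
    have gm: "g j = of_int (m j) * F" if "j \<in> A - {r}" for j
    proof (rule m)
      show "j \<in> A" using that by simp
      show "\<not> (- (of_int (K j) * F) < g j \<and> g j < of_int (K j) * F)"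
        using uniq[of j r] r that by blast
    qed
    have "d = g r + sum g (A - {r})" using A r gsum by (simp add: sum.remove)
    then have gr: "g r = of_int (- M) * F + d"
      using gm by (simp add: M_def sum_distrib_right)
    have sumc: "sum c A = 0" using A r by (simp add: sum.remove[of A r] c_def M_def)
    have sume: "sum e A = (if d = 0 then 0 else 1)"
      using A r by (simp add: e_def sum.delta if_distrib)
    have "g j = of_int (c j) * F + of_int (e j) * d" if "j \<in> A" for j
      using gm[of j] gr that by (cases "j = r") (auto simp: c_def e_def)
    then have cost: "(\<Sum>j\<in>A. b j * (of_int (c j) * F + of_int (e j) * d)) \<le> (\<Sum>j\<in>A. b j * f j)"
      using gcost by (simp cong: sum.cong)
    have "of_int (- K r - 1) * F < of_int (- M) * F" "of_int (- M) * F < of_int (K r) * F"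
      using r(2,3) d unfolding gr by (simp_all add: algebra_simps)
    then have "- K r - 1 < - M" "- M < K r" using F
      by (simp_all only: mult_less_cancel_right of_int_less_iff)
    then have "0 \<le> e j \<and> e j \<le> 1 \<and> - K j \<le> c j \<and> c j \<le> K j - e j" if "j \<in> A" for j
      using mK[OF that] by (auto simp: c_def e_def abs_le_iff)
    then show ?thesis using sumc sume cost by blast
  qed
qed

section \<open>Layered minimum-cost selection with prescribed weight\<close>

text \<open>The combinatorial core, independent of flows and of the machine: for each \<open>j\<close> choose an option
  from \<open>Opt j\<close> such that the weights sum to a prescribed target and the costs
  \<open>num j o' / den j\<close> have minimal sum.  \<open>Y\<close> bounds the cost data, \<open>step\<close> the weights.\<close>

locale layered_search =
  fixes n :: nat and Opt :: "nat \<Rightarrow> 'o set" and wt :: "'o \<Rightarrow> int" and num :: "nat \<Rightarrow> 'o \<Rightarrow> int"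
    and den :: "nat \<Rightarrow> int" and step :: int and Y :: int
  assumes den_pos: "1 \<le> j \<Longrightarrow> j \<le> n \<Longrightarrow> 0 < den j"
    and den_le: "1 \<le> j \<Longrightarrow> j \<le> n \<Longrightarrow> den j \<le> Y"
    and num_le: "1 \<le> j \<Longrightarrow> j \<le> n \<Longrightarrow> o' \<in> Opt j \<Longrightarrow> \<bar>num j o'\<bar> \<le> Y"
    and wt_le: "1 \<le> j \<Longrightarrow> j \<le> n \<Longrightarrow> o' \<in> Opt j \<Longrightarrow> \<bar>wt o'\<bar> \<le> step"
    and step_nonneg: "0 \<le> step" and Y_ge: "2 \<le> Y"
begin

text \<open>Partial sums of weights lie in \<open>[-R, R]\<close>.  With one more \<open>step\<close> than there are layers, the target
  weight of the flow problem lies in this range even if there are no arcs.  The table is stored in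
  arrays, and \<open>addr\<close> places the layers one after the other in windows of width \<open>W\<close>.\<close>

definition R :: int where "R = (int n + 1) * step"
definition W :: int where "W = 2 * R + 1"
definition addr :: "nat \<Rightarrow> int \<Rightarrow> int" where "addr j t = int j * W + t"
definition scale :: "nat \<Rightarrow> int" where "scale j = (\<Prod>i=1..j. den i)"
definition cand :: "(int \<Rightarrow> int) \<Rightarrow> nat \<Rightarrow> int \<Rightarrow> 'o \<Rightarrow> int" where
  "cand v j s o' = v (addr j s) * den (Suc j) + num (Suc j) o' * scale j"

lemma addr_eq_iff:
  assumes "\<bar>s\<bar> \<le> R" "\<bar>t\<bar> \<le> R"
  shows "addr i s = addr j t \<longleftrightarrow> i = j \<and> s = t"
proof
  assume eq: "addr i s = addr j t"
  then have *: "(int i - int j) * W = t - s" by (simp add: addr_def algebra_simps)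
  have "\<bar>int i - int j\<bar> * W < 1 * W"
  proof -
    have "\<bar>int i - int j\<bar> * W = \<bar>t - s\<bar>" using assms unfolding *[symmetric] abs_mult W_def by simp
    then show ?thesis using assms by (simp add: W_def)
  qed
  moreover have "0 < W" using assms by (simp add: W_def)
  ultimately have "\<bar>int i - int j\<bar> < 1" by (simp only: mult_less_cancel_right_pos)
  then have "i = j" by linarith
  with * show "i = j \<and> s = t" by simp
qed simp

lemma scale_pos: "j \<le> n \<Longrightarrow> 0 < scale j"
  unfolding scale_def by (rule prod_pos) (use den_pos in auto)

lemma scale_Suc: "scale (Suc j) = scale j * den (Suc j)"
  by (simp add: scale_def)

lemma scale_le: "j \<le> n \<Longrightarrow> scale j \<le> Y ^ j"
proof (induction j)
  case (Suc j)
  have "scale j * den (Suc j) \<le> Y ^ j * Y"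
    by (rule mult_mono) (use Suc den_le[of "Suc j"] den_pos[of "Suc j"] Y_ge in auto)
  then show ?case by (simp add: scale_Suc mult.commute)
qed (simp add: scale_def)

text \<open>The table consists of three arrays: \<open>r\<close> marks the reached cells (arrays are initially zero, so
  unreached is the default), \<open>v\<close> holds the best known cost of a reached cell, scaled by \<open>scale\<close>,
  and \<open>ch\<close> the option by which the cell was entered.  Soundness says that every reached cell of
  layer \<open>j + 1\<close> is accounted for by its recorded option; completeness for \<open>Pr\<close> says that no pair
  of a reached cell of layer \<open>j\<close> and an option in \<open>Pr\<close> would improve layer \<open>j + 1\<close>.\<close>

definition sound :: "(int \<Rightarrow> int) \<Rightarrow> (int \<Rightarrow> int) \<Rightarrow> (int \<Rightarrow> 'o) \<Rightarrow> nat \<Rightarrow> bool" where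
  "sound r v ch j \<longleftrightarrow> (\<forall>t. \<bar>t\<bar> \<le> R \<longrightarrow> r (addr (Suc j) t) \<noteq> 0 \<longrightarrow>
     (let o' = ch (addr (Suc j) t); s = t - wt o'
      in o' \<in> Opt (Suc j) \<and> \<bar>s\<bar> \<le> R \<and> r (addr j s) \<noteq> 0 \<and> v (addr (Suc j) t) = cand v j s o'))"

definition complete :: "(int \<Rightarrow> int) \<Rightarrow> (int \<Rightarrow> int) \<Rightarrow> nat \<Rightarrow> (int \<times> 'o) set \<Rightarrow> bool" where
  "complete r v j Pr \<longleftrightarrow> (\<forall>s o'. (s, o') \<in> Pr \<longrightarrow> \<bar>s\<bar> \<le> R \<longrightarrow> o' \<in> Opt (Suc j) \<longrightarrow> r (addr j s) \<noteq> 0 \<longrightarrow>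
     r (addr (Suc j) (s + wt o')) \<noteq> 0 \<and> v (addr (Suc j) (s + wt o')) \<le> cand v j s o')"

text \<open>The state of the search while layer \<open>j + 1\<close> is being filled and the pairs in \<open>Pr\<close> have been
  treated.\<close>

definition table :: "nat \<Rightarrow> (int \<times> 'o) set \<Rightarrow> (int \<Rightarrow> int) \<Rightarrow> (int \<Rightarrow> int) \<Rightarrow> (int \<Rightarrow> 'o) \<Rightarrow> bool" where
  "table j Pr r v ch \<longleftrightarrow>
     (\<forall>t. \<bar>t\<bar> \<le> R \<longrightarrow> (r (addr 0 t) \<noteq> 0 \<longleftrightarrow> t = 0)) \<and> v (addr 0 0) = 0 \<and>
     (\<forall>i\<le>j. sound r v ch i) \<and> (\<forall>i<j. complete r v i UNIV) \<and> complete r v j Pr \<and>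
     (\<forall>i t. Suc j < i \<longrightarrow> \<bar>t\<bar> \<le> R \<longrightarrow> r (addr i t) = 0)"

lemma table_mono:
  "table j Pr' r v ch \<Longrightarrow> (\<And>s o'. (s, o') \<in> Pr \<Longrightarrow> \<bar>s\<bar> \<le> R \<Longrightarrow> o' \<in> Opt (Suc j) \<Longrightarrow> r (addr j s) \<noteq> 0 \<Longrightarrow> (s, o') \<in> Pr')
    \<Longrightarrow> table j Pr r v ch"
  unfolding table_def complete_def by blast

lemma table_init:
  "table 0 {} ((\<lambda>_. 0)(0 := 1)) (\<lambda>_. 0) ch"
proof -
  have R: "\<bar>0\<bar> \<le> R" using step_nonneg by (simp add: R_def)
  have "addr i t = 0 \<longleftrightarrow> i = 0 \<and> t = 0" if "\<bar>t\<bar> \<le> R" for i t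
    using addr_eq_iff[OF that R, of i 0] by (simp add: addr_def)
  then show ?thesis by (auto simp: table_def sound_def complete_def)
qed

lemma table_next:
  assumes "table j UNIV r v ch"
  shows "table (Suc j) {} r v ch"
proof -
  have "sound r v ch (Suc j)" using assms by (auto simp: table_def sound_def)
  then show ?thesis using assms by (auto simp: table_def complete_def less_Suc_eq le_Suc_eq)
qed

text \<open>Every layer raises the bound on the scaled costs by a factor of \<open>2 * Y \<le> Y ^ 2\<close>.\<close>

lemma cand_growth:
  assumes j: "j < n" and v: "\<bar>v (addr j s)\<bar> \<le> Y ^ (2 * j)" and o: "o' \<in> Opt (Suc j)"
  shows "\<bar>cand v j s o'\<bar> \<le> Y ^ (2 * Suc j)"
proof -
  have j': "1 \<le> Suc j" "Suc j \<le> n" using j by auto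
  have "\<bar>v (addr j s) * den (Suc j)\<bar> \<le> Y ^ (2 * j) * Y"
    unfolding abs_mult by (rule mult_mono) (use v den_pos[OF j'] den_le[OF j'] Y_ge in auto)
  moreover have "\<bar>num (Suc j) o' * scale j\<bar> \<le> Y * Y ^ (2 * j)"
    unfolding abs_mult
  proof (rule mult_mono)
    have "Y ^ j \<le> Y ^ (2 * j)" using Y_ge by (intro power_increasing) auto
    then show "\<bar>scale j\<bar> \<le> Y ^ (2 * j)" using scale_pos[of j] scale_le[of j] j by simp
  qed (use num_le[OF j' o] Y_ge in auto)
  ultimately have "\<bar>cand v j s o'\<bar> \<le> 2 * (Y * Y ^ (2 * j))" unfolding cand_def by (simp add: mult.commute)
  also have "\<dots> \<le> Y * (Y * Y ^ (2 * j))" using Y_ge by (intro mult_right_mono) auto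
  finally show ?thesis by simp
qed

lemma reached_bound:
  assumes T: "table j Pr r v ch"
  shows "i \<le> Suc j \<Longrightarrow> i \<le> n \<Longrightarrow> \<bar>t\<bar> \<le> R \<Longrightarrow> r (addr i t) \<noteq> 0 \<Longrightarrow>
    \<bar>t\<bar> \<le> int i * step \<and> \<bar>v (addr i t)\<bar> \<le> Y ^ (2 * i)"
proof (induction i arbitrary: t)
  case 0
  then show ?case using T by (auto simp: table_def)
next
  case (Suc i)
  define o' where "o' = ch (addr (Suc i) t)"
  define s where "s = t - wt o'"
  have "sound r v ch i" using T Suc.prems(1) by (auto simp: table_def)
  then have s: "o' \<in> Opt (Suc i)" "\<bar>s\<bar> \<le> R" "r (addr i s) \<noteq> 0" "v (addr (Suc i) t) = cand v i s o'"
    using Suc.prems(3,4) by (auto simp: sound_def Let_def o'_def s_def)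
  have IH: "\<bar>s\<bar> \<le> int i * step" "\<bar>v (addr i s)\<bar> \<le> Y ^ (2 * i)"
    using Suc.IH[of s] s Suc.prems by auto
  have j: "1 \<le> Suc i" "Suc i \<le> n" using Suc.prems by auto
  have "\<bar>t\<bar> \<le> \<bar>s\<bar> + \<bar>wt o'\<bar>" by (simp add: s_def)
  also have "\<dots> \<le> int (Suc i) * step" using IH(1) wt_le[OF j s(1)] by (simp add: algebra_simps)
  finally have "\<bar>t\<bar> \<le> int (Suc i) * step" .
  then show ?case using cand_growth[of i v s o'] IH(2) s(1,4) j by simp
qed

lemma target_in_range:
  assumes "table j Pr r v ch" "j < n" "\<bar>s\<bar> \<le> R" "r (addr j s) \<noteq> 0" "o' \<in> Opt (Suc j)"
  shows "\<bar>s + wt o'\<bar> \<le> R"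
proof -
  have "\<bar>s\<bar> \<le> int j * step" using reached_bound[OF assms(1), of j s] assms by simp
  moreover have "\<bar>wt o'\<bar> \<le> step" using wt_le[of "Suc j" o'] assms by simp
  ultimately have "\<bar>s + wt o'\<bar> \<le> int (Suc j) * step" by (simp add: algebra_simps)
  also have "\<dots> \<le> R" unfolding R_def using assms(2) step_nonneg by (intro mult_right_mono) auto
  finally show ?thesis .
qed

lemma cand_bound:
  assumes T: "table j Pr r v ch" and j: "j < n" and s: "\<bar>s\<bar> \<le> R" "r (addr j s) \<noteq> 0"
    and o: "o' \<in> Opt (Suc j)"
  shows "\<bar>cand v j s o'\<bar> \<le> Y ^ (2 * n)"
proof -
  have "\<bar>v (addr j s)\<bar> \<le> Y ^ (2 * j)" using reached_bound[OF T, of j s] s j by auto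
  then have "\<bar>cand v j s o'\<bar> \<le> Y ^ (2 * Suc j)" by (rule cand_growth[OF j _ o])
  also have "\<dots> \<le> Y ^ (2 * n)" using Y_ge j by (intro power_increasing) auto
  finally show ?thesis .
qed

text \<open>Treating one more pair.  Only a cell of layer \<open>j + 1\<close> is written, so by injectivity of \<open>addr\<close>
  the layer from which the candidates are computed does not change, and the stored cost of a cell
  that was reached before only decreases.\<close>

lemma table_relax:
  assumes T: "table j Pr r v ch" and j: "j < n" and s: "\<bar>s\<bar> \<le> R" "r (addr j s) \<noteq> 0"
    and o: "o' \<in> Opt (Suc j)"
  defines "p \<equiv> addr (Suc j) (s + wt o')"
  shows "r p = 0 \<or> cand v j s o' < v p \<Longrightarrow>
      table j (insert (s, o') Pr) (r(p := 1)) (v(p := cand v j s o')) (ch(p := o'))"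
    and "\<not> (r p = 0 \<or> cand v j s o' < v p) \<Longrightarrow> table j (insert (s, o') Pr) r v ch"
proof -
  assume "\<not> (r p = 0 \<or> cand v j s o' < v p)"
  then show "table j (insert (s, o') Pr) r v ch"
    using T unfolding table_def complete_def p_def by auto
next
  assume better: "r p = 0 \<or> cand v j s o' < v p"
  let ?r = "r(p := 1)" and ?v = "v(p := cand v j s o')" and ?ch = "ch(p := o')"
  have t: "\<bar>s + wt o'\<bar> \<le> R" by (rule target_in_range) fact+
  have eq: "addr i x = p \<longleftrightarrow> i = Suc j \<and> x = s + wt o'" if "\<bar>x\<bar> \<le> R" for i x
    unfolding p_def by (rule addr_eq_iff[OF that t])
  have other: "?r (addr i x) = r (addr i x)" "?v (addr i x) = v (addr i x)" "?ch (addr i x) = ch (addr i x)"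
    if "\<bar>x\<bar> \<le> R" "i \<noteq> Suc j" for i x using eq[OF that(1)] that(2) by auto
  \<comment> \<open>candidates for layer \<open>i + 1\<close> are computed from layer \<open>i\<close>, hence unchanged for \<open>i \<le> j\<close>\<close>
  have candeq: "cand ?v i x y = cand v i x y" if "\<bar>x\<bar> \<le> R" "i \<noteq> Suc j" for i x y
    using other(2)[OF that] by (simp add: cand_def)
  have R0: "\<bar>0\<bar> \<le> R" using t by linarith
  have S: "sound ?r ?v ?ch i" if i: "i \<le> j" for i
    unfolding sound_def Let_def
  proof (intro allI impI)
    fix x assume x: "\<bar>x\<bar> \<le> R" "?r (addr (Suc i) x) \<noteq> 0"
    let ?o = "?ch (addr (Suc i) x)"
    show "?o \<in> Opt (Suc i) \<and> \<bar>x - wt ?o\<bar> \<le> R \<and> ?r (addr i (x - wt ?o)) \<noteq> 0 \<and>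
        ?v (addr (Suc i) x) = cand ?v i (x - wt ?o) ?o"
    proof (cases "addr (Suc i) x = p")
      case True
      then have "i = j" "x = s + wt o'" using eq[OF x(1)] by auto
      then show ?thesis using True s o other(1)[OF s(1)] candeq[OF s(1)] by simp
    next
      case False
      then have "r (addr (Suc i) x) \<noteq> 0" using x(2) by simp
      moreover have "sound r v ch i" using T i by (simp add: table_def)
      ultimately have "?o \<in> Opt (Suc i) \<and> \<bar>x - wt ?o\<bar> \<le> R \<and> r (addr i (x - wt ?o)) \<noteq> 0 \<and>
        v (addr (Suc i) x) = cand v i (x - wt ?o) ?o"
        using False x(1) by (simp add: sound_def Let_def)
      then show ?thesis using False other(1)[of "x - wt ?o" i] candeq[of "x - wt ?o" i] i by simp
    qed
  qed
  have C: "complete ?r ?v i A" if "i \<le> j" "complete r v i A" for i A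
    unfolding complete_def
  proof (intro allI impI)
    fix x y assume xy: "(x, y) \<in> A" "\<bar>x\<bar> \<le> R" "y \<in> Opt (Suc i)" "?r (addr i x) \<noteq> 0"
    have nz: "r (addr i x) \<noteq> 0" using xy(4) other(1)[OF xy(2), of i] that(1) by simp
    have "r (addr (Suc i) (x + wt y)) \<noteq> 0 \<and> v (addr (Suc i) (x + wt y)) \<le> cand v i x y"
      using that(2) xy(1-3) nz unfolding complete_def by blast
    moreover have "cand ?v i x y = cand v i x y" using candeq[OF xy(2)] that(1) by simp
    ultimately show "?r (addr (Suc i) (x + wt y)) \<noteq> 0 \<and> ?v (addr (Suc i) (x + wt y)) \<le> cand ?v i x y"
      using better by auto
  qed
  have C1: "complete ?r ?v j {(s, o')}"
    unfolding complete_def using candeq[OF s(1)] by (auto simp: p_def)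
  have E: "?r (addr i x) = 0" if "Suc j < i" "\<bar>x\<bar> \<le> R" for i x
    using other(1)[of x i] that T by (simp add: table_def)
  have T': "complete r v i UNIV" if "i < j" for i using T that by (simp add: table_def)
  have "complete r v j Pr" using T by (simp add: table_def)
  then have C2: "complete ?r ?v j Pr" by (rule C[OF order_refl])
  have Z: "?r (addr 0 x) \<noteq> 0 \<longleftrightarrow> x = 0" if "\<bar>x\<bar> \<le> R" for x
    using other(1)[OF that, of 0] T that by (simp add: table_def)
  have Z0: "?v (addr 0 0) = 0" using other(2)[OF R0, of 0] T by (simp add: table_def)
  show "table j (insert (s, o') Pr) ?r ?v ?ch"
    unfolding table_def
  proof (intro conjI allI impI)
    show "complete ?r ?v j (insert (s, o') Pr)" using C1 C2 unfolding complete_def by blast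
    show "complete ?r ?v i UNIV" if "i < j" for i using C[OF _ T'] that by simp
  qed (fact Z Z0 E | rule S Z Z0 E; assumption)+
qed

definition ratio :: "nat \<Rightarrow> 'o \<Rightarrow> real" where
  "ratio j o' = of_int (num j o') / of_int (den j)"

lemma cand_ratio:
  assumes "j < n"
  shows "of_int (cand v j s o') / of_int (scale (Suc j)) =
    of_int (v (addr j s)) / of_int (scale j) + ratio (Suc j) o'"
proof -
  have "scale j > 0" "den (Suc j) > 0" using assms scale_pos[of j] den_pos[of "Suc j"] by auto
  then show ?thesis by (simp add: cand_def ratio_def scale_Suc field_simps)
qed

lemma path_sum_bound:
  assumes "j \<le> n" "\<And>i. 1 \<le> i \<Longrightarrow> i \<le> j \<Longrightarrow> os i \<in> Opt i"
  shows "\<bar>\<Sum>i=1..j. wt (os i)\<bar> \<le> R"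
proof -
  have "\<bar>\<Sum>i=1..j. wt (os i)\<bar> \<le> (\<Sum>i=1..j. step)"
    by (rule order_trans[OF sum_abs sum_mono]) (use assms wt_le in auto)
  also have "\<dots> = int j * step" by simp
  also have "\<dots> \<le> R" unfolding R_def using assms(1) step_nonneg by (intro mult_right_mono) auto
  finally show ?thesis .
qed

text \<open>Following any selection of options through the filled table, completeness bounds the stored cost
  of the cells on the way by the cost of the selection so far.\<close>

lemma table_optimal:
  assumes T: "table n {} r v ch"
  shows "j \<le> n \<Longrightarrow> (\<And>i. 1 \<le> i \<Longrightarrow> i \<le> j \<Longrightarrow> os i \<in> Opt i) \<Longrightarrow>
    r (addr j (\<Sum>i=1..j. wt (os i))) \<noteq> 0 \<and>
    of_int (v (addr j (\<Sum>i=1..j. wt (os i)))) / of_int (scale j) \<le> (\<Sum>i=1..j. ratio i (os i))"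
proof (induction j)
  case 0
  have "\<bar>0\<bar> \<le> R" using step_nonneg by (simp add: R_def)
  then show ?case using T by (simp add: table_def)
next
  case (Suc j)
  let ?s = "\<Sum>i=1..j. wt (os i)" and ?o = "os (Suc j)"
  have j: "j < n" using Suc.prems(1) by simp
  have IH: "r (addr j ?s) \<noteq> 0" "of_int (v (addr j ?s)) / of_int (scale j) \<le> (\<Sum>i=1..j. ratio i (os i))"
    using Suc by auto
  have "complete r v j UNIV" using T j by (simp add: table_def)
  moreover have "\<bar>?s\<bar> \<le> R" by (rule path_sum_bound) (use Suc.prems in auto)
  moreover have "?o \<in> Opt (Suc j)" using Suc.prems(2) by simp
  ultimately have c: "r (addr (Suc j) (?s + wt ?o)) \<noteq> 0" "v (addr (Suc j) (?s + wt ?o)) \<le> cand v j ?s ?o"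
    using IH(1) unfolding complete_def by blast+
  have "real_of_int (v (addr (Suc j) (?s + wt ?o))) / of_int (scale (Suc j)) \<le>
      of_int (cand v j ?s ?o) / of_int (scale (Suc j))"
    using c(2) scale_pos[of "Suc j"] Suc.prems(1) by (intro divide_right_mono) auto
  then show ?case using c(1) IH(2) cand_ratio[OF j, of v ?s ?o] by simp
qed

text \<open>The invariant of backtracking from target \<open>t\<close>: the options for the layers after \<open>j\<close> are known and
  account for the difference between the cell \<open>(j, s)\<close> and the target cell, in weight and in cost.\<close>

definition suffix_choice :: "(int \<Rightarrow> int) \<Rightarrow> (int \<Rightarrow> int) \<Rightarrow> int \<Rightarrow> nat \<Rightarrow> int \<Rightarrow> (nat \<Rightarrow> 'o) \<Rightarrow> bool" where
  "suffix_choice r v t j s os \<longleftrightarrow> \<bar>s\<bar> \<le> R \<and> r (addr j s) \<noteq> 0 \<and>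
     (\<forall>i\<in>{j<..n}. os i \<in> Opt i) \<and> s + (\<Sum>i\<in>{j<..n}. wt (os i)) = t \<and>
     of_int (v (addr j s)) / of_int (scale j) + (\<Sum>i\<in>{j<..n}. ratio i (os i)) =
       of_int (v (addr n t)) / (of_int (scale n) :: real)"

lemma suffix_choice_extend:
  assumes T: "table n {} r v ch" and S: "suffix_choice r v t (Suc j) s os" and j: "j < n"
    and o': "os (Suc j) = ch (addr (Suc j) s)"
  shows "suffix_choice r v t j (s - wt (os (Suc j))) os"
proof -
  have split: "{j<..n} = insert (Suc j) {Suc j<..n}" using j by auto
  have "sound r v ch j" using T j by (simp add: table_def)
  then have 1: "os (Suc j) \<in> Opt (Suc j)" "\<bar>s - wt (os (Suc j))\<bar> \<le> R"
      "r (addr j (s - wt (os (Suc j)))) \<noteq> 0"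
      "v (addr (Suc j) s) = cand v j (s - wt (os (Suc j))) (os (Suc j))"
    using S o' by (auto simp: sound_def suffix_choice_def Let_def)
  then show ?thesis
    using S cand_ratio[OF j, of v "s - wt (os (Suc j))" "os (Suc j)"]
    by (simp add: suffix_choice_def split algebra_simps)
qed

lemma suffix_choice_cong:
  "suffix_choice r v t j s os \<Longrightarrow> (\<And>i. j < i \<Longrightarrow> i \<le> n \<Longrightarrow> os' i = os i) \<Longrightarrow> suffix_choice r v t j s os'"
  using sum.cong[of "{j<..n}" "{j<..n}" "\<lambda>i. wt (os' i)" "\<lambda>i. wt (os i)"]
    sum.cong[of "{j<..n}" "{j<..n}" "\<lambda>i. ratio i (os' i)" "\<lambda>i. ratio i (os i)"]
  by (auto simp: suffix_choice_def)

lemma suffix_choice_complete: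
  assumes T: "table n {} r v ch" and S: "suffix_choice r v t 0 s os"
  shows "(\<forall>i\<in>{1..n}. os i \<in> Opt i) \<and> (\<Sum>i=1..n. wt (os i)) = t \<and>
    (\<Sum>i=1..n. ratio i (os i)) = of_int (v (addr n t)) / of_int (scale n)"
proof -
  have "{0<..n} = {1..n}" by auto
  moreover have "s = 0" using T S by (auto simp: table_def suffix_choice_def)
  ultimately show ?thesis using T S by (auto simp: table_def suffix_choice_def)
qed

end

section \<open>Step counts and the cost of a step\<close>

lemma bits_less: "\<bar>z\<bar> < 2 ^ (bits z - 1)"
proof (cases "z = 0")
  case False
  then have "nat \<bar>z\<bar> < 2 ^ floorlog 2 (nat \<bar>z\<bar>)"
    using floorlog_bounds[of "nat \<bar>z\<bar>" 2] by simp
  then have "int (nat \<bar>z\<bar>) < 2 ^ floorlog 2 (nat \<bar>z\<bar>)"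
    by (metis of_nat_less_iff of_nat_numeral of_nat_power)
  then show ?thesis by (simp add: bits_def)
qed simp

lemma bits_le: "\<bar>z\<bar> < 2 ^ k \<Longrightarrow> bits z \<le> Suc k"
proof -
  assume a: "\<bar>z\<bar> < 2 ^ k"
  then have "int (nat \<bar>z\<bar>) < int (2 ^ k)" by simp
  then have "nat \<bar>z\<bar> < 2 ^ k" by linarith
  then have "floorlog 2 (nat \<bar>z\<bar>) \<le> k"
    by (simp add: floorlog_le_iff)
  then show ?thesis by (simp add: bits_def)
qed

lemma bits_pos: "bits z > 0" by (simp add: bits_def)

lemma bits_add_le: "bits (x + y) \<le> bits x + bits y"
proof -
  let ?a = "bits x - 1" and ?b = "bits y - 1"
  have "\<bar>x\<bar> < 2 ^ ?a" "\<bar>y\<bar> < 2 ^ ?b" by (rule bits_less)+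
  moreover have "(2::int) ^ ?a \<le> 2 ^ (?a + ?b)" "(2::int) ^ ?b \<le> 2 ^ (?a + ?b)"
    by (rule power_increasing; simp)+
  ultimately have "\<bar>x + y\<bar> < 2 ^ Suc (?a + ?b)" unfolding power_Suc by linarith
  from bits_le[OF this] bits_pos[of x] bits_pos[of y] show ?thesis by simp
qed

lemma bits_minus: "bits (- x) = bits x" by (simp add: bits_def)

lemma bits_diff_le: "bits (x - y) \<le> bits x + bits y"
  using bits_add_le[of x "- y"] by (simp add: bits_minus)

lemma bits_mult_le: "bits (x * y) \<le> bits x + bits y"
proof -
  have "\<bar>x * y\<bar> < 2 ^ ((bits x - 1) + (bits y - 1))"
    unfolding abs_mult power_add by (rule mult_strict_mono') (auto intro: bits_less simp del: One_nat_def)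
  from bits_le[OF this] show ?thesis using bits_pos[of x] bits_pos[of y] by simp
qed

text \<open>All time bounds rest on a magnitude \<open>2 ^ m\<close> that no memory cell ever exceeds: then evaluating a
  fixed expression costs at most a constant, depending on the expression only, times \<open>m + 2\<close>.
  The functions below compute such constants.\<close>

definition small :: "nat \<Rightarrow> store \<Rightarrow> bool" where
  "small m s \<longleftrightarrow> (\<forall>v i. \<bar>s v i\<bar> \<le> 2 ^ m)"

fun width :: "aexp \<Rightarrow> nat" where
  "width (Const z) = bits z"
| "width (Read v a) = 1"
| "width (Add a b) = width a + width b"
| "width (Sub a b) = width a + width b"
| "width (Mul a b) = width a + width b"

fun acoef :: "aexp \<Rightarrow> nat" where
  "acoef (Const z) = bits z"
| "acoef (Read v a) = acoef a + 1"
| "acoef (Add a b) = acoef a + acoef b + width a + width b"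
| "acoef (Sub a b) = acoef a + acoef b + width a + width b"
| "acoef (Mul a b) = acoef a + acoef b + width a + width b"

fun bcoef :: "bexp \<Rightarrow> nat" where
  "bcoef (Less a b) = acoef a + acoef b + 1"
| "bcoef (Eq a b) = acoef a + acoef b + 1"
| "bcoef (Neg b) = bcoef b + 1"
| "bcoef (Conj b c) = bcoef b + bcoef c + 1"

fun coef :: "com \<Rightarrow> nat" where
  "coef Skip = 1"
| "coef (Write v a b) = acoef a + acoef b"
| "coef (Seq c d) = coef c + coef d"
| "coef (Cond b c d) = bcoef b + coef c + coef d"
| "coef (While b c) = bcoef b + coef c"

lemma width_bound:
  assumes "small m s"
  shows "bits (aval a s) \<le> width a * (m + 2)"
proof (induction a)
  case (Const z)
  then show ?case by simp
next
  case (Read v a)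
  have "\<bar>s v (aval a s)\<bar> < 2 ^ Suc m"
    using assms[unfolded small_def, rule_format, of v "aval a s"]
    by (rule le_less_trans) (rule power_strict_increasing; simp)
  from bits_le[OF this] show ?case by simp
next
  case (Add a b)
  then show ?case using bits_add_le[of "aval a s" "aval b s"] by (simp add: algebra_simps)
next
  case (Sub a b)
  then show ?case using bits_diff_le[of "aval a s" "aval b s"] by (simp add: algebra_simps)
next
  case (Mul a b)
  then show ?case using bits_mult_le[of "aval a s" "aval b s"] by (simp add: algebra_simps)
qed

lemma acost_bound:
  assumes "small m s"
  shows "acost a s \<le> acoef a * (m + 2)"
proof (induction a)
  case (Read v a)
  then show ?case using width_bound[OF assms, of "Read v a"] by simp
next
  case (Add a b)
  then show ?case using width_bound[OF assms, of "Add a b"] by (simp add: algebra_simps)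
next
  case (Sub a b)
  then show ?case using width_bound[OF assms, of "Sub a b"] by (simp add: algebra_simps)
next
  case (Mul a b)
  then show ?case using width_bound[OF assms, of "Mul a b"] by (simp add: algebra_simps)
qed simp

lemma bcost_bound:
  assumes "small m s"
  shows "bcost b s \<le> bcoef b * (m + 2)"
proof (induction b)
  case (Less x y)
  then show ?case using acost_bound[OF assms, of x] acost_bound[OF assms, of y]
    by (simp add: algebra_simps)
next
  case (Eq x y)
  then show ?case using acost_bound[OF assms, of x] acost_bound[OF assms, of y]
    by (simp add: algebra_simps)
qed (simp_all add: algebra_simps)

text \<open>Total correctness with a step count \<open>N\<close>.  The unit \<open>coef c * (m + 2)\<close> bounds the cost of any
  single assignment or test in \<open>c\<close>, so that step counts add up along the program structure
  without carrying the constants of the individual expressions.\<close>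

definition triple :: "nat \<Rightarrow> (store \<Rightarrow> bool) \<Rightarrow> com \<Rightarrow> nat \<Rightarrow> (store \<Rightarrow> bool) \<Rightarrow> bool" where
  "triple m P c N Q \<longleftrightarrow> (\<forall>s. P s \<and> small m s \<longrightarrow>
     (\<exists>t s'. exec c s t s' \<and> t \<le> N * (coef c * (m + 2)) \<and> small m s' \<and> Q s'))"

lemma small_update: "small m s \<Longrightarrow> \<bar>z\<bar> \<le> 2 ^ m \<Longrightarrow> small m (update s v i z)"
  by (simp add: small_def update_def)

lemma triple_conseq:
  assumes "triple m P c N Q" "\<And>s. P' s \<Longrightarrow> P s" "N \<le> N'" "\<And>s. Q s \<Longrightarrow> Q' s"
  shows "triple m P' c N' Q'"
  unfolding triple_def
proof (intro allI impI)
  fix s assume "P' s \<and> small m s"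
  then obtain t s' where "exec c s t s'" "t \<le> N * (coef c * (m + 2))" "small m s'" "Q s'"
    using assms(1,2) unfolding triple_def by blast
  moreover have "N * (coef c * (m + 2)) \<le> N' * (coef c * (m + 2))"
    using assms(3) by (rule mult_right_mono) simp
  ultimately show "\<exists>t s'. exec c s t s' \<and> t \<le> N' * (coef c * (m + 2)) \<and> small m s' \<and> Q' s'"
    using assms(4) by (meson order_trans)
qed

lemma triple_Seq:
  assumes "triple m P c1 N1 Q" "triple m Q c2 N2 Q'"
  shows "triple m P (Seq c1 c2) (N1 + N2) Q'"
  unfolding triple_def
proof (intro allI impI)
  fix s assume "P s \<and> small m s"
  then obtain t s' where 1: "exec c1 s t s'" "t \<le> N1 * (coef c1 * (m + 2))" "small m s'" "Q s'"
    using assms(1) unfolding triple_def by blast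
  then obtain u s'' where 2: "exec c2 s' u s''" "u \<le> N2 * (coef c2 * (m + 2))" "small m s''" "Q' s''"
    using assms(2) unfolding triple_def by blast
  have "t + u \<le> (N1 + N2) * (coef (Seq c1 c2) * (m + 2))"
    using 1(2) 2(2) by (simp add: algebra_simps)
  then show "\<exists>t s'. exec (Seq c1 c2) s t s' \<and> t \<le> (N1 + N2) * (coef (Seq c1 c2) * (m + 2)) \<and>
      small m s' \<and> Q' s'"
    using exec.Seq[OF 1(1) 2(1)] 2(3,4) by blast
qed

lemma triple_Write:
  assumes "\<And>s. P s \<Longrightarrow> small m s \<Longrightarrow>
    \<bar>aval b s\<bar> \<le> 2 ^ m \<and> Q (update s v (aval a s) (aval b s))"
  shows "triple m P (Write v a b) 1 Q"
  unfolding triple_def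
proof (intro allI impI)
  fix s assume s: "P s \<and> small m s"
  have "acost a s + acost b s \<le> 1 * (coef (Write v a b) * (m + 2))"
    using acost_bound[of m s a] acost_bound[of m s b] s by (simp add: algebra_simps)
  then show "\<exists>t s'. exec (Write v a b) s t s' \<and> t \<le> 1 * (coef (Write v a b) * (m + 2)) \<and>
      small m s' \<and> Q s'"
    using exec.Write[of v a b s] assms[of s] s small_update by blast
qed

lemma triple_Skip: "triple m P Skip 1 P"
  unfolding triple_def using exec.Skip by fastforce

lemma triple_Cond:
  assumes "triple m (\<lambda>s. P s \<and> bval b s) c1 N Q" "triple m (\<lambda>s. P s \<and> \<not> bval b s) c2 N Q"
  shows "triple m P (Cond b c1 c2) (Suc N) Q"
  unfolding triple_def
proof (intro allI impI)
  fix s assume s: "P s \<and> small m s"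
  have bc: "bcost b s \<le> bcoef b * (m + 2)" using bcost_bound s by blast
  show "\<exists>t s'. exec (Cond b c1 c2) s t s' \<and> t \<le> Suc N * (coef (Cond b c1 c2) * (m + 2)) \<and>
      small m s' \<and> Q s'"
  proof (cases "bval b s")
    case True
    then obtain t s' where 1: "exec c1 s t s'" "t \<le> N * (coef c1 * (m + 2))" "small m s'" "Q s'"
      using assms(1) s unfolding triple_def by blast
    have "bcost b s + t \<le> Suc N * (coef (Cond b c1 c2) * (m + 2))"
      using 1(2) bc by (simp add: algebra_simps)
    then show ?thesis using exec.CondTrue[OF True 1(1)] 1(3,4) by blast
  next
    case False
    then obtain t s' where 1: "exec c2 s t s'" "t \<le> N * (coef c2 * (m + 2))" "small m s'" "Q s'"
      using assms(2) s unfolding triple_def by blast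
    have "bcost b s + t \<le> Suc N * (coef (Cond b c1 c2) * (m + 2))"
      using 1(2) bc by (simp add: algebra_simps)
    then show ?thesis using exec.CondFalse[OF False 1(1)] 1(3,4) by blast
  qed
qed

text \<open>The invariant is indexed by the number of iterations done, which also settles termination: the
  test must hold before each of the \<open>k\<close> iterations and fail after them.\<close>

lemma triple_While:
  assumes "\<And>i. i < k \<Longrightarrow> triple m (J i) c N (J (Suc i))"
    and "\<And>i s. i < k \<Longrightarrow> J i s \<Longrightarrow> bval b s" and "\<And>s. J k s \<Longrightarrow> \<not> bval b s"
  shows "triple m (J 0) (While b c) (1 + k * (N + 1)) (J k)"
proof -
  have "triple m (J i) (While b c) (1 + (k - i) * (N + 1)) (J k)" if "i \<le> k" for i
    using that
  proof (induction rule: inc_induct)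
    case base
    show ?case unfolding triple_def
    proof (intro allI impI)
      fix s assume s: "J k s \<and> small m s"
      then have "bcost b s \<le> (1 + (k - k) * (N + 1)) * (coef (While b c) * (m + 2))"
        using bcost_bound[of m s b] by (simp add: algebra_simps)
      then show "\<exists>t s'. exec (While b c) s t s' \<and>
          t \<le> (1 + (k - k) * (N + 1)) * (coef (While b c) * (m + 2)) \<and> small m s' \<and> J k s'"
        using exec.WhileFalse[of b s c] s assms(3) by blast
    qed
  next
    case (step i)
    show ?case unfolding triple_def
    proof (intro allI impI)
      fix s assume s: "J i s \<and> small m s"
      then obtain t s' where 1: "exec c s t s'" "t \<le> N * (coef c * (m + 2))" "small m s'" "J (Suc i) s'"
        using assms(1)[OF step.hyps(2)] unfolding triple_def by blast
      then obtain u s'' where 2: "exec (While b c) s' u s''"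
          "u \<le> (1 + (k - Suc i) * (N + 1)) * (coef (While b c) * (m + 2))" "small m s''" "J k s''"
        using step.IH unfolding triple_def by blast
      have 3: "bcost b s \<le> bcoef b * (m + 2)" using bcost_bound s by blast
      have "k - i = Suc (k - Suc i)" using step.hyps by simp
      then have "bcost b s + t + u \<le> (1 + (k - i) * (N + 1)) * (coef (While b c) * (m + 2))"
        using 1(2) 2(2) 3 by (simp add: algebra_simps)
      then show "\<exists>t s'. exec (While b c) s t s' \<and>
          t \<le> (1 + (k - i) * (N + 1)) * (coef (While b c) * (m + 2)) \<and> small m s' \<and> J k s'"
        using exec.WhileTrue[OF assms(2)[OF step.hyps(2)] 1(1) 2(1)] s 2(3,4) by blast
    qed
  qed
  from this[of 0] show ?thesis by simp
qed

abbreviation scalar :: "vname \<Rightarrow> aexp" where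
  "scalar v \<equiv> Read v (Const 0)"

definition For :: "vname \<Rightarrow> aexp \<Rightarrow> aexp \<Rightarrow> com \<Rightarrow> com" where
  "For v lo hi c = Seq (Write v (Const 0) lo)
     (While (Neg (Less hi (scalar v)))
       (Seq c (Write v (Const 0) (Add (scalar v) (Const 1)))))"

text \<open>\<open>J i\<close> describes the store before the iteration with counter value \<open>i\<close>.  It must not mention the
  counter itself, because the counter is incremented between the iterations.\<close>

lemma triple_For:
  assumes body: "\<And>i. l \<le> i \<Longrightarrow> i \<le> h \<Longrightarrow>
      triple m (\<lambda>s. J i s \<and> s v 0 = i) c N (\<lambda>s. J (i + 1) s \<and> s v 0 = i)"
    and indep: "\<And>i s z. J i s \<Longrightarrow> J i (update s v 0 z)"
    and hi: "\<And>i s. J i s \<Longrightarrow> aval hi s = h"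
    and lo: "\<And>s. P s \<Longrightarrow> aval lo s = l \<and> J l s"
    and range: "l \<le> h + 1" "\<bar>l\<bar> \<le> 2 ^ m" "\<bar>h + 1\<bar> \<le> 2 ^ m"
    and post: "\<And>s. J (h + 1) s \<Longrightarrow> Q s"
    and steps: "2 + nat (h + 1 - l) * (N + 2) \<le> N'"
  shows "triple m P (For v lo hi c) N' Q"
proof -
  define k where "k = nat (h + 1 - l)"
  have k: "l + int k = h + 1" unfolding k_def using range by simp
  let ?J = "\<lambda>i s. J (l + int i) s \<and> s v 0 = l + int i"
  let ?b = "Neg (Less hi (scalar v))"
  let ?w = "While ?b (Seq c (Write v (Const 0) (Add (scalar v) (Const 1))))"
  have init: "triple m P (Write v (Const 0) lo) 1 (?J 0)"
    by (rule triple_Write) (use lo indep range in \<open>auto simp: update_def\<close>)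
  have "triple m (?J i) (Seq c (Write v (Const 0) (Add (scalar v) (Const 1)))) (N + 1) (?J (Suc i))"
    if "i < k" for i
  proof (rule triple_Seq)
    let ?i = "l + int i"
    have i: "?i \<le> h" using k that by linarith
    show "triple m (?J i) c N (\<lambda>s. J (?i + 1) s \<and> s v 0 = ?i)"
      by (rule body) (use i in auto)
    have "\<bar>?i + 1\<bar> \<le> 2 ^ m" using range i by linarith
    then show "triple m (\<lambda>s. J (?i + 1) s \<and> s v 0 = ?i)
        (Write v (Const 0) (Add (scalar v) (Const 1))) 1 (?J (Suc i))"
      by (intro triple_Write) (use indep in \<open>auto simp: update_def add.commute add.left_commute\<close>)
  qed
  then have loop: "triple m (?J 0) ?w (1 + k * (N + 1 + 1)) (?J k)"
  proof (rule triple_While)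
    fix i s assume "i < k" "?J i s"
    then show "bval ?b s" using hi[of "l + int i" s] k by auto
  next
    fix s assume "?J k s"
    then show "\<not> bval ?b s" using hi[of "l + int k" s] k by auto
  qed
  show ?thesis
    unfolding For_def
    by (rule triple_conseq[OF triple_Seq[OF init loop]]) (use k post steps in \<open>auto simp: k_def\<close>)
qed

text \<open>Loop-free code is verified by symbolic execution: \<open>run\<close> computes the final store and \<open>fits\<close>
  collects the magnitude conditions for all values written on the way.\<close>

fun straight :: "com \<Rightarrow> bool" where
  "straight Skip = True"
| "straight (Write v a b) = True"
| "straight (Seq c d) = (straight c \<and> straight d)"
| "straight (Cond b c d) = (straight c \<and> straight d)"
| "straight (While b c) = False"

fun run :: "com \<Rightarrow> store \<Rightarrow> store" where
  "run Skip s = s"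
| "run (Write v a b) s = update s v (aval a s) (aval b s)"
| "run (Seq c d) s = run d (run c s)"
| "run (Cond b c d) s = (if bval b s then run c s else run d s)"
| "run (While b c) s = s"

fun fits :: "nat \<Rightarrow> com \<Rightarrow> store \<Rightarrow> bool" where
  "fits m Skip s = True"
| "fits m (Write v a b) s = (\<bar>aval b s\<bar> \<le> 2 ^ m)"
| "fits m (Seq c d) s = (fits m c s \<and> fits m d (run c s))"
| "fits m (Cond b c d) s = (if bval b s then fits m c s else fits m d s)"
| "fits m (While b c) s = False"

fun straight_length :: "com \<Rightarrow> nat" where
  "straight_length (Seq c d) = straight_length c + straight_length d"
| "straight_length (Cond b c d) = Suc (max (straight_length c) (straight_length d))"
| "straight_length _ = 1"

lemma triple_run:
  "straight c \<Longrightarrow> triple m (\<lambda>s. fits m c s \<and> Q (run c s)) c (straight_length c) Q"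
proof (induction c arbitrary: Q)
  case Skip
  show ?case by (rule triple_conseq[OF triple_Skip]) auto
next
  case (Write v a b)
  show ?case by (simp add: triple_Write[simplified])
next
  case (Seq c d)
  then have "triple m (\<lambda>s. fits m c s \<and> fits m d (run c s) \<and> Q (run d (run c s))) (Seq c d)
      (straight_length c + straight_length d) Q"
    by (intro triple_Seq[where Q = "\<lambda>s. fits m d s \<and> Q (run d s)"] Seq.IH) auto
  then show ?case by (simp add: conj_assoc)
next
  case (Cond b c d)
  then show ?case
    by simp (rule triple_Cond; rule triple_conseq[OF Cond.IH(1)] triple_conseq[OF Cond.IH(2)]; auto)
qed simp

lemma triple_straight:
  assumes "straight c" "\<And>s. P s \<Longrightarrow> small m s \<Longrightarrow> fits m c s \<and> Q (run c s)"
    and "straight_length c \<le> N"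
  shows "triple m P c N Q"
proof -
  have "triple m (\<lambda>s. fits m c s \<and> Q (run c s)) c (straight_length c) Q"
    by (rule triple_run) fact
  then have "triple m P c (straight_length c) Q" using assms(2) unfolding triple_def by blast
  then show ?thesis by (rule triple_conseq) (use assms(3) in auto)
qed

section \<open>Filling the table\<close>

notation Add (infixl "\<oplus>" 65) and Sub (infixl "\<ominus>" 65) and Mul (infixl "\<otimes>" 70)
  and Seq (infixr ";;" 60)

text \<open>Expressions that read the encoded instance, for the arc whose number is in \<open>j\<close>.  The input array
  holds the dimension \<open>n\<close> at index 1, the factors \<open>kappa\<close> at \<open>2, \<dots>, n + 1\<close>, then numerator and
  denominator of \<open>fbar\<close> and of the demand, then \<open>n\<close> such pairs for \<open>coeff_x\<close> and \<open>n + 1\<close> pairs for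
  \<open>coeff_f\<close>.\<close>

definition dimE :: aexp where "dimE = Read ''in'' (Const 1)"
definition capE :: aexp where "capE = Read ''in'' (scalar ''j'' \<oplus> Const 1)"
definition fbar_numE :: aexp where "fbar_numE = Read ''in'' (dimE \<oplus> Const 2)"
definition fbar_denE :: aexp where "fbar_denE = Read ''in'' (dimE \<oplus> Const 3)"
definition demand_numE :: aexp where "demand_numE = Read ''in'' (dimE \<oplus> Const 4)"
definition demand_denE :: aexp where "demand_denE = Read ''in'' (dimE \<oplus> Const 5)"
definition x_numE :: aexp where "x_numE = Read ''in'' (dimE \<oplus> Const 4 \<oplus> Const 2 \<otimes> scalar ''j'')"
definition x_denE :: aexp where "x_denE = Read ''in'' (dimE \<oplus> Const 5 \<oplus> Const 2 \<otimes> scalar ''j'')"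
definition f_numE :: aexp where
  "f_numE = Read ''in'' (Const 3 \<otimes> dimE \<oplus> Const 6 \<oplus> Const 2 \<otimes> scalar ''j'')"
definition f_denE :: aexp where
  "f_denE = Read ''in'' (Const 3 \<otimes> dimE \<oplus> Const 7 \<oplus> Const 2 \<otimes> scalar ''j'')"

text \<open>The weight unit \<open>H = kb * n + 1\<close> exceeds the absolute value of any sum of \<open>n\<close> integers of size at
  most \<open>kb\<close>.\<close>

definition unitE :: "nat \<Rightarrow> aexp" where "unitE kb = Const (int kb) \<otimes> dimE \<oplus> Const 1"
definition radiusE :: "nat \<Rightarrow> aexp" where
  "radiusE kb = (dimE \<oplus> Const 1) \<otimes> (Const (int kb) \<oplus> unitE kb)"
definition widthE :: "nat \<Rightarrow> aexp" where "widthE kb = Const 2 \<otimes> radiusE kb \<oplus> Const 1"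

definition flow_numE :: "aexp \<Rightarrow> aexp \<Rightarrow> aexp" where
  "flow_numE e c = c \<otimes> fbar_numE \<otimes> demand_denE \<oplus> e \<otimes> demand_numE \<otimes> fbar_denE"
definition flow_denE :: aexp where "flow_denE = fbar_denE \<otimes> demand_denE"
text \<open>The cost of choice \<open>(x, e, c)\<close> is a fraction with the denominators of both cost coefficients, of
  \<open>fbar\<close> and of the demand multiplied together.  The sign \<open>sg\<close> turns maximization into
  minimization.\<close>

definition cost_denE :: aexp where "cost_denE = x_denE \<otimes> (f_denE \<otimes> flow_denE)"
definition cost_numE :: "int \<Rightarrow> aexp" where
  "cost_numE sg = Const sg \<otimes> (scalar ''x'' \<otimes> (x_numE \<otimes> (f_denE \<otimes> flow_denE)) \<oplus>
     f_numE \<otimes> x_denE \<otimes> flow_numE (scalar ''e'') (scalar ''c''))"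

definition sourceE :: "nat \<Rightarrow> aexp" where
  "sourceE kb = (scalar ''j'' \<ominus> Const 1) \<otimes> widthE kb \<oplus> scalar ''s''"
definition candE :: "nat \<Rightarrow> int \<Rightarrow> aexp" where
  "candE kb sg = Read ''v'' (sourceE kb) \<otimes> cost_denE \<oplus> cost_numE sg \<otimes> scalar ''D''"
definition targetE :: "nat \<Rightarrow> aexp" where
  "targetE kb = scalar ''j'' \<otimes> widthE kb \<oplus>
     (scalar ''s'' \<oplus> (unitE kb \<otimes> scalar ''e'' \<oplus> scalar ''c''))"

definition relax_prog :: "nat \<Rightarrow> int \<Rightarrow> com" where
  "relax_prog kb sg =
     Write ''cand'' (Const 0) (candE kb sg) ;;
     Write ''tgt'' (Const 0) (targetE kb) ;;
     Cond (Neg (Conj (Neg (Eq (Read ''r'' (scalar ''tgt'')) (Const 0)))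
                     (Neg (Less (scalar ''cand'') (Read ''v'' (scalar ''tgt''))))))
       (Write ''r'' (scalar ''tgt'') (Const 1) ;;
        Write ''v'' (scalar ''tgt'') (scalar ''cand'') ;;
        Write ''cx'' (scalar ''tgt'') (scalar ''x'') ;;
        Write ''ce'' (scalar ''tgt'') (scalar ''e'') ;;
        Write ''cc'' (scalar ''tgt'') (scalar ''c''))
       Skip"

definition options_prog :: "nat \<Rightarrow> int \<Rightarrow> com" where
  "options_prog kb sg =
     For ''x'' (Const 0) (Const 1)
       (For ''e'' (Const 0) (scalar ''x'')
         (For ''c'' (Const 0 \<ominus> capE \<otimes> scalar ''x'') (capE \<otimes> scalar ''x'' \<ominus> scalar ''e'')
           (relax_prog kb sg)))"

definition layer_prog :: "nat \<Rightarrow> int \<Rightarrow> com" where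
  "layer_prog kb sg =
     For ''s'' (Const 0 \<ominus> radiusE kb) (radiusE kb)
       (Cond (Eq (Read ''r'' (sourceE kb)) (Const 0)) Skip (options_prog kb sg)) ;;
     Write ''D'' (Const 0) (scalar ''D'' \<otimes> cost_denE)"

definition table_prog :: "nat \<Rightarrow> int \<Rightarrow> com" where
  "table_prog kb sg =
     (Write ''r'' (Const 0) (Const 1) ;; Write ''D'' (Const 0) (Const 1)) ;;
     For ''j'' (Const 1) dimE (layer_prog kb sg)"

text \<open>The integers that make up an instance, with their positions in the input array \<open>inp\<close>.  The number
  \<open>l\<close> is going to be the bit size of the input.\<close>

locale flow_data =
  fixes n kb :: nat and k :: "nat \<Rightarrow> int" and fn fd dn dd :: int and an ad bn bd :: "nat \<Rightarrow> int"
    and sg :: int and inp :: "int \<Rightarrow> int" and l :: nat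
  assumes inp_dim: "inp 1 = int n"
    and inp_cap: "1 \<le> j \<Longrightarrow> j \<le> n \<Longrightarrow> inp (int j + 1) = k j"
    and inp_glob: "inp (int n + 2) = fn" "inp (int n + 3) = fd" "inp (int n + 4) = dn" "inp (int n + 5) = dd"
    and inp_x: "1 \<le> j \<Longrightarrow> j \<le> n \<Longrightarrow> inp (int n + 4 + 2 * int j) = an j"
      "1 \<le> j \<Longrightarrow> j \<le> n \<Longrightarrow> inp (int n + 5 + 2 * int j) = ad j"
    and inp_f: "1 \<le> j \<Longrightarrow> j \<le> n \<Longrightarrow> inp (3 * int n + 6 + 2 * int j) = bn j"
      "1 \<le> j \<Longrightarrow> j \<le> n \<Longrightarrow> inp (3 * int n + 7 + 2 * int j) = bd j"
    and cap_range: "1 \<le> j \<Longrightarrow> j \<le> n \<Longrightarrow> 0 \<le> k j" "1 \<le> j \<Longrightarrow> j \<le> n \<Longrightarrow> k j \<le> int kb"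
    and den_positive: "0 < fd" "0 < dd" "1 \<le> j \<Longrightarrow> j \<le> n \<Longrightarrow> 0 < ad j" "1 \<le> j \<Longrightarrow> j \<le> n \<Longrightarrow> 0 < bd j"
    and inp_le: "\<bar>inp i\<bar> \<le> 2 ^ l"
    and sg: "\<bar>sg\<bar> = 1"
begin

text \<open>All numbers in memory are bounded by \<open>2 ^ m\<close>: each input number, \<open>n + 1\<close> and \<open>kb + 3\<close> are
  at most \<open>2 ^ z\<close>, the cost data of an arc at most \<open>2 ^ (5 * z)\<close>, and the costs in the table
  at most \<open>(2 ^ (5 * z)) ^ (2 * n)\<close> by \<open>reached_bound\<close>.\<close>

definition z :: nat where "z = kb + 3 + l"
definition m :: nat where "m = 10 * z * (n + 1)"
definition H :: int where "H = int kb * int n + 1"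

definition Opt :: "nat \<Rightarrow> (int \<times> int \<times> int) set" where
  "Opt j = {(x, e, c). 0 \<le> x \<and> x \<le> 1 \<and> 0 \<le> e \<and> e \<le> x \<and> - (k j * x) \<le> c \<and> c \<le> k j * x - e}"
fun wt :: "int \<times> int \<times> int \<Rightarrow> int" where "wt (x, e, c) = H * e + c"
definition flow_num :: "int \<Rightarrow> int \<Rightarrow> int" where "flow_num e c = c * fn * dd + e * dn * fd"
fun num :: "nat \<Rightarrow> int \<times> int \<times> int \<Rightarrow> int" where
  "num j (x, e, c) = sg * (x * (an j * (bd j * (fd * dd))) + bn j * ad j * flow_num e c)"
definition den :: "nat \<Rightarrow> int" where "den j = ad j * (bd j * (fd * dd))"

lemma Z_ge: "int kb + 3 \<le> 2 ^ z" "2 ^ l \<le> (2::int) ^ z" "int n + 1 \<le> 2 ^ z"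
proof -
  have p: "int i + 1 \<le> 2 ^ i" for i by (induction i) auto
  have "int kb + 3 + int l + 1 \<le> 2 ^ z" using p[of z] by (simp add: z_def)
  then show "int kb + 3 \<le> 2 ^ z" by linarith
  show "2 ^ l \<le> (2::int) ^ z" unfolding z_def by (intro power_increasing) auto
  have "int n \<le> 2 ^ l" using inp_le[of 1] inp_dim by simp
  moreover have "(2::int) ^ Suc l \<le> 2 ^ z" unfolding z_def by (intro power_increasing) auto
  moreover have "(1::int) \<le> 2 ^ l" by simp
  ultimately show "int n + 1 \<le> 2 ^ z" unfolding power_Suc by linarith
qed

lemma inp_bounds:
  "\<bar>fn\<bar> \<le> 2 ^ l" "\<bar>fd\<bar> \<le> 2 ^ l" "\<bar>dn\<bar> \<le> 2 ^ l" "\<bar>dd\<bar> \<le> 2 ^ l"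
  "1 \<le> j \<Longrightarrow> j \<le> n \<Longrightarrow> \<bar>an j\<bar> \<le> 2 ^ l" "1 \<le> j \<Longrightarrow> j \<le> n \<Longrightarrow> \<bar>ad j\<bar> \<le> 2 ^ l"
  "1 \<le> j \<Longrightarrow> j \<le> n \<Longrightarrow> \<bar>bn j\<bar> \<le> 2 ^ l" "1 \<le> j \<Longrightarrow> j \<le> n \<Longrightarrow> \<bar>bd j\<bar> \<le> 2 ^ l"
  using inp_le inp_glob inp_x inp_f by metis+

lemma abs_mult_le: "\<bar>x\<bar> \<le> a \<Longrightarrow> \<bar>y\<bar> \<le> b \<Longrightarrow> \<bar>x * y\<bar> \<le> a * (b :: int)"
  unfolding abs_mult by (rule mult_mono) auto

lemma flow_den_bound: "\<bar>fd * dd\<bar> \<le> 2 ^ l * 2 ^ l"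
  by (intro abs_mult_le inp_bounds)

lemma flow_num_bound:
  assumes "\<bar>e\<bar> \<le> 1" "\<bar>c\<bar> \<le> int kb"
  shows "\<bar>flow_num e c\<bar> \<le> (int kb + 1) * (2 ^ l * 2 ^ l)"
proof -
  have "\<bar>c * fn * dd\<bar> \<le> int kb * 2 ^ l * 2 ^ l" "\<bar>e * dn * fd\<bar> \<le> 1 * 2 ^ l * 2 ^ l"
    by (intro abs_mult_le inp_bounds assms)+
  then show ?thesis unfolding flow_num_def by (simp add: algebra_simps)
qed

lemma Opt_bound:
  assumes "1 \<le> j" "j \<le> n" "(x, e, c) \<in> Opt j"
  shows "0 \<le> x" "x \<le> 1" "0 \<le> e" "e \<le> x" "\<bar>e\<bar> \<le> 1" "\<bar>c\<bar> \<le> int kb"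
proof -
  have "x = 0 \<or> x = 1" using assms(3) by (auto simp: Opt_def)
  then show "0 \<le> x" "x \<le> 1" "0 \<le> e" "e \<le> x" "\<bar>e\<bar> \<le> 1" "\<bar>c\<bar> \<le> int kb"
    using assms(3) cap_range[OF assms(1,2)] by (auto simp: Opt_def)
qed

lemma num_bound:
  assumes "1 \<le> j" "j \<le> n" "o' \<in> Opt j"
  shows "\<bar>num j o'\<bar> \<le> 2 ^ (5 * z)"
proof (cases o')
  case (fields x e c)
  note b = Opt_bound[OF assms(1,2) assms(3)[unfolded fields]]
  let ?E = "(2::int) ^ l"
  have "\<bar>x * (an j * (bd j * (fd * dd)))\<bar> \<le> 1 * (?E * (?E * (?E * ?E)))"
    by (intro abs_mult_le inp_bounds assms) (use b in auto)
  moreover have "\<bar>bn j * ad j * flow_num e c\<bar> \<le> ?E * ?E * ((int kb + 1) * (?E * ?E))"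
    by (intro abs_mult_le inp_bounds assms flow_num_bound) (use b in auto)
  ultimately have "\<bar>x * (an j * (bd j * (fd * dd))) + bn j * ad j * flow_num e c\<bar> \<le>
      (int kb + 2) * (?E * ?E * (?E * ?E))" by (simp add: algebra_simps)
  also have "\<dots> \<le> 2 ^ z * (2 ^ z * 2 ^ z * (2 ^ z * 2 ^ z))"
    by (intro mult_mono) (use Z_ge in auto)
  also have "\<dots> = 2 ^ (5 * z)" by (simp flip: power_add)
  finally show ?thesis using sg by (simp add: fields abs_mult)
qed

lemma den_bound:
  assumes "1 \<le> j" "j \<le> n"
  shows "0 < den j" "den j \<le> 2 ^ (5 * z)"
proof -
  let ?E = "(2::int) ^ l"
  show "0 < den j" using den_positive assms by (simp add: den_def)
  have "\<bar>den j\<bar> \<le> ?E * (?E * (?E * ?E))"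
    unfolding den_def by (intro abs_mult_le inp_bounds assms)
  also have "\<dots> = 2 ^ (4 * l)" by (simp flip: power_add)
  also have "\<dots> \<le> 2 ^ (5 * z)" by (intro power_increasing) (auto simp: z_def)
  finally show "den j \<le> 2 ^ (5 * z)" by simp
qed

lemma wt_bound:
  assumes "1 \<le> j" "j \<le> n" "o' \<in> Opt j"
  shows "\<bar>wt o'\<bar> \<le> int kb + H"
proof (cases o')
  case (fields x e c)
  note b = Opt_bound[OF assms(1,2) assms(3)[unfolded fields]]
  have "0 \<le> H" by (simp add: H_def)
  then have "\<bar>H * e\<bar> \<le> H * 1" unfolding abs_mult by (intro mult_mono) (use b in auto)
  then show ?thesis using b by (simp add: fields)
qed

sublocale layered_search n Opt wt num den "int kb + H" "2 ^ (5 * z)"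
proof
  show "2 \<le> (2::int) ^ (5 * z)" using power_increasing[of 1 "5 * z" "2::int"] by (simp add: z_def)
qed (use num_bound den_bound wt_bound in \<open>auto simp: H_def\<close>)

lemma fits_bounds:
  "int n + 1 \<le> 2 ^ m" "int kb + 1 \<le> 2 ^ m" "H \<le> 2 ^ m" "R + 1 \<le> 2 ^ m" "int n * W + R \<le> 2 ^ m"
  "(2 ^ (5 * z)) ^ (2 * n) \<le> (2::int) ^ m" "scale n \<le> 2 ^ m" "3 * int n + 3 \<le> 2 ^ m" "2 \<le> (2::int) ^ m"
  "(int kb + 1) * (2 ^ l * 2 ^ l) \<le> 2 ^ m" "2 ^ l * 2 ^ l \<le> (2::int) ^ m" and R_nonneg: "0 \<le> R"
proof -
  let ?Z = "(2::int) ^ z"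
  have Z8: "8 \<le> ?Z" using power_increasing[of 3 z "2::int"] by (simp add: z_def)
  have le: "(2::int) ^ (i * z) \<le> 2 ^ m" if "i \<le> 10" for i
  proof (rule power_increasing)
    have "i * z \<le> 10 * z" using that by (rule mult_right_mono) simp
    also have "\<dots> \<le> m" by (simp add: m_def)
    finally show "i * z \<le> m" .
  qed simp
  have Z1: "?Z \<le> 2 ^ m" using le[of 1] by simp
  show "int n + 1 \<le> 2 ^ m" "int kb + 1 \<le> 2 ^ m" "2 \<le> (2::int) ^ m" using Z_ge Z8 Z1 by linarith+
  have "3 * (int n + 1) \<le> ?Z * ?Z" by (intro mult_mono) (use Z_ge Z8 in auto)
  also have "\<dots> \<le> 2 ^ m" using le[of 2] by (simp add: power_add mult_2)
  finally show "3 * int n + 3 \<le> 2 ^ m" by simp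
  have H: "int kb + H \<le> (int kb + 1) * (int n + 1)" by (simp add: H_def algebra_simps)
  also have "\<dots> \<le> ?Z * ?Z" by (intro mult_mono) (use Z_ge in auto)
  finally have step: "int kb + H \<le> ?Z * ?Z" .
  have H0: "0 \<le> H" by (simp add: H_def)
  have "?Z * ?Z \<le> 2 ^ m" using le[of 2] by (simp add: power_add mult_2)
  then show "H \<le> 2 ^ m" using step H0 by linarith
  show R0: "0 \<le> R" using H0 by (simp add: R_def)
  have R3: "R \<le> ?Z * (?Z * ?Z)" unfolding R_def
    by (intro mult_mono step Z_ge(3)) (use H0 in auto)
  have Zs: "8 * 8 * 8 \<le> ?Z * ?Z * ?Z" by (intro mult_mono) (use Z8 in auto)
  then have "W \<le> 3 * (?Z * (?Z * ?Z))" using R3 by (simp add: W_def)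
  also have "\<dots> \<le> ?Z * (?Z * (?Z * ?Z))" using Z8 by (intro mult_right_mono) auto
  finally have W4: "W \<le> ?Z * (?Z * (?Z * ?Z))" .
  have W0: "0 \<le> W" using R0 by (simp add: W_def)
  have "(int n + 1) * W \<le> ?Z * (?Z * (?Z * (?Z * ?Z)))"
    by (intro mult_mono W4) (use Z_ge W0 in auto)
  also have "\<dots> = 2 ^ (5 * z)" by (simp flip: power_add)
  finally have W5: "(int n + 1) * W \<le> 2 ^ m" using le[of 5] by linarith
  then show "int n * W + R \<le> 2 ^ m" using R0 by (simp add: W_def algebra_simps)
  have "1 * (R + 1) \<le> (int n + 1) * W" by (intro mult_mono) (use R0 in \<open>auto simp: W_def\<close>)
  then show "R + 1 \<le> 2 ^ m" using W5 by (simp only: mult_1 order_trans)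
  have "(2 ^ (5 * z)) ^ (2 * n) = (2::int) ^ (10 * z * n)" by (simp add: algebra_simps flip: power_mult)
  also have "\<dots> \<le> 2 ^ m" by (intro power_increasing) (auto simp: m_def)
  finally show Y: "(2 ^ (5 * z)) ^ (2 * n) \<le> (2::int) ^ m" .
  have "scale n \<le> (2 ^ (5 * z)) ^ n" by (rule scale_le) simp
  also have "\<dots> \<le> (2 ^ (5 * z)) ^ (2 * n)" by (rule power_increasing) auto
  finally show "scale n \<le> 2 ^ m" using Y by linarith
  have "(int kb + 1) * (2 ^ l * 2 ^ l) \<le> ?Z * (?Z * ?Z)" by (intro mult_mono) (use Z_ge in auto)
  also have "\<dots> = 2 ^ (3 * z)" by (simp flip: power_add)
  also have "\<dots> \<le> 2 ^ m" by (rule le) simp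
  finally show "(int kb + 1) * (2 ^ l * 2 ^ l) \<le> 2 ^ m" .
  have "2 ^ l * 2 ^ l \<le> ?Z * ?Z" by (intro mult_mono) (use Z_ge in auto)
  also have "\<dots> = 2 ^ (2 * z)" by (simp flip: power_add)
  also have "\<dots> \<le> 2 ^ m" by (rule le) simp
  finally show "2 ^ l * 2 ^ l \<le> (2::int) ^ m" .
qed

lemma aval_const[simp]:
  assumes "st ''in'' = inp"
  shows "aval dimE st = int n" "aval fbar_numE st = fn" "aval fbar_denE st = fd"
    "aval demand_numE st = dn" "aval demand_denE st = dd" "aval flow_denE st = fd * dd"
    "aval (unitE kb) st = H" "aval (radiusE kb) st = R" "aval (widthE kb) st = W"
    "aval (flow_numE a b) st = flow_num (aval a st) (aval b st)"
proof -
  show dim: "aval dimE st = int n" using assms inp_dim by (simp add: dimE_def)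
  show glob: "aval fbar_numE st = fn" "aval fbar_denE st = fd"
    "aval demand_numE st = dn" "aval demand_denE st = dd"
    using assms inp_glob dim
    by (simp_all add: fbar_numE_def fbar_denE_def demand_numE_def demand_denE_def)
  show "aval flow_denE st = fd * dd" "aval (flow_numE a b) st = flow_num (aval a st) (aval b st)"
    by (simp_all add: flow_denE_def flow_numE_def flow_num_def glob)
  show unit: "aval (unitE kb) st = H" by (simp add: unitE_def dim H_def)
  show radius: "aval (radiusE kb) st = R" by (simp add: radiusE_def dim unit R_def)
  show "aval (widthE kb) st = W" by (simp add: widthE_def radius W_def)
qed

lemma aval_item:
  assumes "st ''in'' = inp" "st ''j'' 0 = int j" "1 \<le> j" "j \<le> n"
  shows "aval capE st = k j" "aval cost_denE st = den j"
    "aval (cost_numE sg) st = num j (st ''x'' 0, st ''e'' 0, st ''c'' 0)"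
  using assms inp_cap inp_x inp_f
  by (simp_all add: capE_def cost_denE_def cost_numE_def x_numE_def x_denE_def f_numE_def f_denE_def
      den_def add.commute)


text \<open>The store while the pairs in \<open>Pr\<close> are being treated for layer \<open>j + 1\<close>.  The output array is still
  untouched, which is used when the answer is that there is no feasible point.\<close>

definition filling :: "nat \<Rightarrow> (int \<times> int \<times> int \<times> int) set \<Rightarrow> store \<Rightarrow> bool" where
  "filling j Pr st \<longleftrightarrow> st ''in'' = inp \<and> st ''out'' = (\<lambda>_. 0) \<and> st ''D'' 0 = scale j \<and>
     table j Pr (st ''r'') (st ''v'') (\<lambda>p. (st ''cx'' p, st ''ce'' p, st ''cc'' p))"

text \<open>The pairs treated by four nested loops over \<open>s\<close>, \<open>x\<close>, \<open>e\<close> and \<open>c\<close> before the given loop state, in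
  lexicographic order.  It serves as the invariant of all four loops: at the end of an inner loop it
  covers, among the pairs that occur at all, the next state of the outer loop.\<close>

definition before :: "int \<Rightarrow> int \<Rightarrow> int \<Rightarrow> int \<Rightarrow> (int \<times> int \<times> int \<times> int) set" where
  "before s x e c = {(s', x', e', c'). s' < s \<or> s' = s \<and> (x' < x \<or> x' = x \<and> (e' < e \<or> e' = e \<and> c' < c))}"

lemma filling_update[simp]:
  assumes "v \<notin> {''in'', ''out'', ''D'', ''r'', ''v'', ''cx'', ''ce'', ''cc''}"
  shows "filling j Pr (update st v i y) = filling j Pr st"
proof -
  have "update st v i y w = st w" if "w \<in> {''in'', ''out'', ''D'', ''r'', ''v'', ''cx'', ''ce'', ''cc''}" for w
  proof -
    have "w \<noteq> v" using that assms by blast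
    then show ?thesis by (simp add: update_def)
  qed
  then show ?thesis by (simp add: filling_def)
qed

text \<open>Moves from one loop state to the next, and past a cell that is not reached: pairs that cannot
  contribute may be counted as treated.\<close>

lemma filling_mono:
  assumes "filling j Pr' st"
    and "\<And>s x e c. (s, x, e, c) \<in> Pr \<Longrightarrow> \<bar>s\<bar> \<le> R \<Longrightarrow> (x, e, c) \<in> Opt (Suc j) \<Longrightarrow> st ''r'' (addr j s) \<noteq> 0 \<Longrightarrow> (s, x, e, c) \<in> Pr'"
  shows "filling j Pr st"
  using assms unfolding filling_def by (auto elim!: table_mono)

text \<open>The loop body realizes the case distinction of \<open>table_relax\<close>.\<close>

lemma relax_triple:
  assumes j: "j < n" and s: "\<bar>s\<bar> \<le> R" and o: "(x, e, c) \<in> Opt (Suc j)"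
  shows "triple m
    (\<lambda>st. filling j (before s x e c) st \<and> st ''j'' 0 = int (Suc j) \<and> st ''s'' 0 = s \<and> st ''r'' (addr j s) \<noteq> 0 \<and>
       st ''x'' 0 = x \<and> st ''e'' 0 = e \<and> st ''c'' 0 = c)
    (relax_prog kb sg) 8
    (\<lambda>st. filling j (before s x e (c + 1)) st \<and> st ''j'' 0 = int (Suc j) \<and> st ''s'' 0 = s \<and> st ''r'' (addr j s) \<noteq> 0 \<and>
       st ''x'' 0 = x \<and> st ''e'' 0 = e \<and> st ''c'' 0 = c)"
    (is "triple m ?P _ _ ?Q")
proof (rule triple_straight)
  show "straight (relax_prog kb sg)" by (simp add: relax_prog_def)
  show "straight_length (relax_prog kb sg) \<le> 8" by (simp add: relax_prog_def)
  have j1: "1 \<le> Suc j" "Suc j \<le> n" using j by auto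
  note ob = Opt_bound[OF j1 o]
  fix st assume P: "?P st"
  define p where "p = addr (Suc j) (s + wt (x, e, c))"
  define cv where "cv = cand (st ''v'') j s (x, e, c)"
  let ?ch = "\<lambda>p. (st ''cx'' p, st ''ce'' p, st ''cc'' p)"
  have T: "table j (before s x e c) (st ''r'') (st ''v'') ?ch" and inp: "st ''in'' = inp"
    and D: "st ''D'' 0 = scale j" and out: "st ''out'' = (\<lambda>_. 0)"
    using P by (auto simp: filling_def)
  have src: "aval (sourceE kb) st = addr j s"
    using inp P by (simp add: sourceE_def addr_def)
  have "st ''j'' 0 = int (Suc j)" using P by blast
  note item = aval_item[OF inp this j1]
  have cand: "aval (candE kb sg) st = cv"
    using P D item(2,3) by (simp add: candE_def src cv_def cand_def)
  have tgt: "aval (targetE kb) (update st ''cand'' 0 cv) = p"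
    using inp P by (simp add: targetE_def update_def p_def addr_def)
  have nz: "st ''r'' (addr j s) \<noteq> 0" using P by blast
  have cvb: "\<bar>cv\<bar> \<le> 2 ^ m"
    using cand_bound[OF T j s nz o] fits_bounds(6) unfolding cv_def by linarith
  have t: "\<bar>s + wt (x, e, c)\<bar> \<le> R" by (rule target_in_range[OF T j s nz o])
  have "\<bar>p\<bar> \<le> int (Suc j) * W + R"
  proof -
    have "0 \<le> int (Suc j) * W" using R_nonneg by (simp add: W_def)
    then show ?thesis using t by (simp add: p_def addr_def del: of_nat_Suc)
  qed
  also have "\<dots> \<le> int n * W + R" using j1 R_nonneg by (intro add_right_mono mult_right_mono) (auto simp: W_def)
  also have "\<dots> \<le> 2 ^ m" by (rule fits_bounds)
  finally have pb: "\<bar>p\<bar> \<le> 2 ^ m" .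
  have small: "1 \<le> (2::int) ^ m" "\<bar>x\<bar> \<le> 2 ^ m" "\<bar>e\<bar> \<le> 2 ^ m" "\<bar>c\<bar> \<le> 2 ^ m"
    using ob fits_bounds(2,9) by auto
  let ?b = "st ''r'' p = 0 \<or> cv < st ''v'' p"
  have fits: "fits m (relax_prog kb sg) st"
    using P cvb pb small by (simp add: relax_prog_def cand tgt) (simp add: update_def)
  let ?st1 = "update (update st ''cand'' 0 cv) ''tgt'' 0 p"
  have run: "run (relax_prog kb sg) st = (if ?b
      then update (update (update (update (update ?st1 ''r'' p 1) ''v'' p cv) ''cx'' p x) ''ce'' p e) ''cc'' p c
      else ?st1)"
    using P by (simp add: relax_prog_def cand tgt) (simp add: update_def)
  \<comment> \<open>the treated pair is the only one that the increment of \<open>c\<close> adds\<close>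
  have ins: "table j (before s x e (c + 1)) r v ch" if "table j (insert (s, x, e, c) (before s x e c)) r v ch" for r v ch
    using that by (rule table_mono) (auto simp: before_def)
  have notp: "addr j s \<noteq> p" unfolding p_def using addr_eq_iff[OF s t] by simp
  show "fits m (relax_prog kb sg) st \<and> ?Q (run (relax_prog kb sg) st)"
  proof (cases ?b)
    case True
    let ?st2 = "update (update (update (update (update ?st1 ''r'' p 1) ''v'' p cv) ''cx'' p x) ''ce'' p e) ''cc'' p c"
    have "table j (before s x e (c + 1)) ((st ''r'')(p := 1)) ((st ''v'')(p := cv)) (?ch(p := (x, e, c)))"
      using table_relax(1)[OF T j s nz o] True unfolding p_def cv_def by (intro ins) simp
    moreover have "(\<lambda>q. (?st2 ''cx'' q, ?st2 ''ce'' q, ?st2 ''cc'' q)) = ?ch(p := (x, e, c))"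
      by (auto simp: update_def fun_eq_iff)
    moreover have "?st2 ''r'' = (st ''r'')(p := 1)" "?st2 ''v'' = (st ''v'')(p := cv)" "?st2 ''in'' = inp"
      "?st2 ''out'' = (\<lambda>_. 0)" "?st2 ''D'' 0 = scale j"
      using inp D out by (auto simp: update_def)
    ultimately have "filling j (before s x e (c + 1)) ?st2" unfolding filling_def by simp
    moreover have "?st2 ''j'' = st ''j''" "?st2 ''s'' = st ''s''" "?st2 ''x'' = st ''x''" "?st2 ''e'' = st ''e''"
      "?st2 ''c'' = st ''c''" "?st2 ''r'' (addr j s) \<noteq> 0" using notp nz by (auto simp: update_def)
    ultimately show ?thesis using fits P unfolding run using True by simp
  next
    case False
    have "table j (before s x e (c + 1)) (st ''r'') (st ''v'') ?ch"
      using table_relax(2)[OF T j s nz o] False unfolding p_def cv_def by (intro ins) simp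
    then have "filling j (before s x e (c + 1)) ?st1" using inp D out by (simp, simp add: filling_def)
    moreover have "?st1 ''j'' = st ''j''" "?st1 ''s'' = st ''s''" "?st1 ''x'' = st ''x''" "?st1 ''e'' = st ''e''"
      "?st1 ''c'' = st ''c''" "?st1 ''r'' = st ''r''" by (auto simp: update_def)
    ultimately show ?thesis using fits P unfolding run using False by simp
  qed
qed


definition options_steps :: nat where "options_steps = 2 + 2 * (2 + 2 * (2 + (2 * kb + 1) * 10 + 2) + 2)"

lemma options_triple:
  assumes j: "j < n" and s: "\<bar>s\<bar> \<le> R"
  defines "F \<equiv> \<lambda>st. st ''j'' 0 = int (Suc j) \<and> st ''s'' 0 = s \<and> st ''r'' (addr j s) \<noteq> 0"
  shows "triple m (\<lambda>st. filling j (before s 0 0 0) st \<and> F st) (options_prog kb sg) options_steps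
    (\<lambda>st. filling j (before (s + 1) 0 0 0) st \<and> F st)"
proof -
  define K where "K = k (Suc j)"
  have j1: "1 \<le> Suc j" "Suc j \<le> n" using j by auto
  have K: "0 \<le> K" "K \<le> int kb" unfolding K_def by (rule cap_range[OF j1])+
  have opt: "(x, e, c) \<in> Opt (Suc j) \<longleftrightarrow> 0 \<le> x \<and> x \<le> 1 \<and> 0 \<le> e \<and> e \<le> x \<and> - (K * x) \<le> c \<and> c \<le> K * x - e" for x e c
    by (simp add: Opt_def K_def)
  have Findep: "F (update st v 0 y) = F st" if "v \<in> {''x'', ''e'', ''c''}" for st v y
    using that by (auto simp: F_def update_def)
  let ?I = "\<lambda>x e c st. filling j (before s x e c) st \<and> F st"
  have inner: "triple m (\<lambda>st. ?I x e (- (K * x)) st \<and> st ''x'' 0 = x \<and> st ''e'' 0 = e)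
      (For ''c'' (Const 0 \<ominus> capE \<otimes> scalar ''x'') (capE \<otimes> scalar ''x'' \<ominus> scalar ''e'') (relax_prog kb sg))
      (2 + (2 * kb + 1) * 10)
      (\<lambda>st. ?I x (e + 1) (- (K * x)) st \<and> st ''x'' 0 = x \<and> st ''e'' 0 = e)"
    if x: "0 \<le> x" "x \<le> 1" and e: "0 \<le> e" "e \<le> x" for x e
  proof (rule triple_For[where N = 8 and l = "- (K * x)" and h = "K * x - e"
      and J = "\<lambda>c st. ?I x e c st \<and> st ''x'' 0 = x \<and> st ''e'' 0 = e"])
    have x01: "x = 0 \<or> x = 1" using x by auto
    show "triple m (\<lambda>st. (?I x e c st \<and> st ''x'' 0 = x \<and> st ''e'' 0 = e) \<and> st ''c'' 0 = c) (relax_prog kb sg) 8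
       (\<lambda>st. (?I x e (c + 1) st \<and> st ''x'' 0 = x \<and> st ''e'' 0 = e) \<and> st ''c'' 0 = c)"
      if "- (K * x) \<le> c" "c \<le> K * x - e" for c
      by (rule triple_conseq[OF relax_triple[OF j s, of x e c]])
        (use that x e in \<open>auto simp: opt F_def\<close>)
    show "?I x e c (update st ''c'' 0 y) \<and> update st ''c'' 0 y ''x'' 0 = x \<and> update st ''c'' 0 y ''e'' 0 = e"
      if "?I x e c st \<and> st ''x'' 0 = x \<and> st ''e'' 0 = e" for c st y
      using that by (simp add: Findep) (simp add: update_def)
    have cap: "aval capE st = K" if "filling j Pr st" "F st" for Pr st
      unfolding K_def by (rule aval_item[OF _ _ j1]) (use that in \<open>auto simp: filling_def F_def\<close>)
    show "aval (capE \<otimes> scalar ''x'' \<ominus> scalar ''e'') st = K * x - e"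
      if "?I x e c st \<and> st ''x'' 0 = x \<and> st ''e'' 0 = e" for c st
      using that cap by auto
    show "aval (Const 0 \<ominus> capE \<otimes> scalar ''x'') st = - (K * x) \<and>
        ?I x e (- (K * x)) st \<and> st ''x'' 0 = x \<and> st ''e'' 0 = e"
      if "?I x e (- (K * x)) st \<and> st ''x'' 0 = x \<and> st ''e'' 0 = e" for st
      using that cap by auto
    show "- (K * x) \<le> K * x - e + 1" using x01 K e by auto
    show "\<bar>- (K * x)\<bar> \<le> 2 ^ m" "\<bar>K * x - e + 1\<bar> \<le> 2 ^ m" using x01 K e fits_bounds(2) by auto
    have "nat (K * x - e + 1 - - (K * x)) \<le> 2 * kb + 1" using x01 K e by auto
    then show "2 + nat (K * x - e + 1 - - (K * x)) * (8 + 2) \<le> 2 + (2 * kb + 1) * 10" by simp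
    show "?I x (e + 1) (- (K * x)) st \<and> st ''x'' 0 = x \<and> st ''e'' 0 = e"
      if "?I x e (K * x - e + 1) st \<and> st ''x'' 0 = x \<and> st ''e'' 0 = e" for st
      using that by (auto elim!: filling_mono simp: before_def opt)
  qed
  have middle: "triple m (\<lambda>st. ?I x 0 (- (K * x)) st \<and> st ''x'' 0 = x)
      (For ''e'' (Const 0) (scalar ''x'')
        (For ''c'' (Const 0 \<ominus> capE \<otimes> scalar ''x'') (capE \<otimes> scalar ''x'' \<ominus> scalar ''e'') (relax_prog kb sg)))
      (2 + 2 * (2 + (2 * kb + 1) * 10 + 2))
      (\<lambda>st. ?I (x + 1) 0 (- (K * (x + 1))) st \<and> st ''x'' 0 = x)"
    if x: "0 \<le> x" "x \<le> 1" for x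
  proof (rule triple_For[where N = "2 + (2 * kb + 1) * 10" and l = 0 and h = x
      and J = "\<lambda>e st. ?I x e (- (K * x)) st \<and> st ''x'' 0 = x"])
    show "triple m (\<lambda>st. (?I x e (- (K * x)) st \<and> st ''x'' 0 = x) \<and> st ''e'' 0 = e)
       (For ''c'' (Const 0 \<ominus> capE \<otimes> scalar ''x'') (capE \<otimes> scalar ''x'' \<ominus> scalar ''e'') (relax_prog kb sg))
       (2 + (2 * kb + 1) * 10)
       (\<lambda>st. (?I x (e + 1) (- (K * x)) st \<and> st ''x'' 0 = x) \<and> st ''e'' 0 = e)"
      if "0 \<le> e" "e \<le> x" for e
      by (rule triple_conseq[OF inner[OF x that]]) auto
    show "?I x e (- (K * x)) (update st ''e'' 0 y) \<and> update st ''e'' 0 y ''x'' 0 = x"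
      if "?I x e (- (K * x)) st \<and> st ''x'' 0 = x" for e st y
      using that by (simp add: Findep) (simp add: update_def)
    show "aval (Const 0) st = 0 \<and> ?I x 0 (- (K * x)) st \<and> st ''x'' 0 = x"
      if "?I x 0 (- (K * x)) st \<and> st ''x'' 0 = x" for st
      using that by simp
    show "aval (scalar ''x'') st = x" if "?I x e (- (K * x)) st \<and> st ''x'' 0 = x" for e st
      using that by simp
    show "0 \<le> x + 1" "\<bar>0\<bar> \<le> (2::int) ^ m" "\<bar>x + 1\<bar> \<le> 2 ^ m" using x fits_bounds(9) by auto
    have "nat (x + 1 - 0) \<le> 2" using x by auto
    then show "2 + nat (x + 1 - 0) * (2 + (2 * kb + 1) * 10 + 2) \<le> 2 + 2 * (2 + (2 * kb + 1) * 10 + 2)"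
      by (intro add_left_mono mult_right_mono) auto
    show "?I (x + 1) 0 (- (K * (x + 1))) st \<and> st ''x'' 0 = x"
      if "?I x (x + 1) (- (K * x)) st \<and> st ''x'' 0 = x" for st
      using that by (auto elim!: filling_mono simp: before_def opt)
  qed
  show ?thesis
    unfolding options_prog_def options_steps_def
  proof (rule triple_For[where N = "2 + 2 * (2 + (2 * kb + 1) * 10 + 2)" and l = 0 and h = 1
      and J = "\<lambda>x st. ?I x 0 (- (K * x)) st"])
    show "triple m (\<lambda>st. ?I x 0 (- (K * x)) st \<and> st ''x'' 0 = x)
       (For ''e'' (Const 0) (scalar ''x'')
        (For ''c'' (Const 0 \<ominus> capE \<otimes> scalar ''x'') (capE \<otimes> scalar ''x'' \<ominus> scalar ''e'') (relax_prog kb sg)))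
       (2 + 2 * (2 + (2 * kb + 1) * 10 + 2))
       (\<lambda>st. ?I (x + 1) 0 (- (K * (x + 1))) st \<and> st ''x'' 0 = x)"
      if "0 \<le> x" "x \<le> 1" for x
      by (rule middle[OF that])
    show "aval (Const 0) st = 0 \<and> ?I 0 0 (- (K * 0)) st" if "filling j (before s 0 0 0) st \<and> F st" for st
      using that by simp
    show "?I x 0 (- (K * x)) (update st ''x'' 0 y)" if "?I x 0 (- (K * x)) st" for x st y
      using that by (simp add: Findep)
    show "filling j (before (s + 1) 0 0 0) st \<and> F st" if "?I (1 + 1) 0 (- (K * (1 + 1))) st" for st
      using that by (auto elim!: filling_mono simp: before_def opt)
    show "\<bar>1 + 1\<bar> \<le> (2::int) ^ m" using fits_bounds(9) by simp
  qed auto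
qed

definition layer_steps :: nat where
  "layer_steps = 2 + (2 * (n + 1) * (kb + kb * n + 1) + 1) * (options_steps + 3) + 1"

lemma nat_R: "nat (R + 1 - - R) = 2 * (n + 1) * (kb + kb * n + 1) + 1"
proof -
  have "R = int ((n + 1) * (kb + kb * n + 1))" unfolding R_def unfolding H_def by (simp add: algebra_simps)
  then have "R + 1 - - R = int (2 * (n + 1) * (kb + kb * n + 1) + 1)" by simp
  then show ?thesis by (simp only: nat_int)
qed

lemma layer_triple:
  assumes j: "j < n"
  shows "triple m (\<lambda>st. filling j {} st \<and> st ''j'' 0 = int (Suc j)) (layer_prog kb sg) layer_steps
    (\<lambda>st. filling (Suc j) {} st \<and> st ''j'' 0 = int (Suc j))"
proof -
  have j1: "1 \<le> Suc j" "Suc j \<le> n" using j by auto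
  let ?F = "\<lambda>s st. st ''j'' 0 = int (Suc j) \<and> st ''s'' 0 = s"
  have cell: "triple m (\<lambda>st. filling j (before s 0 0 0) st \<and> ?F s st)
     (Cond (Eq (Read ''r'' (sourceE kb)) (Const 0)) Skip (options_prog kb sg)) (Suc options_steps)
     (\<lambda>st. filling j (before (s + 1) 0 0 0) st \<and> ?F s st)" if s: "\<bar>s\<bar> \<le> R" for s
  proof (rule triple_Cond)
    have src: "aval (sourceE kb) st = addr j s" if "filling j Pr st" "?F s st" for Pr st
      using that by (simp add: filling_def sourceE_def addr_def)
    show "triple m (\<lambda>st. (filling j (before s 0 0 0) st \<and> ?F s st) \<and> bval (Eq (Read ''r'' (sourceE kb)) (Const 0)) st)
       Skip options_steps (\<lambda>st. filling j (before (s + 1) 0 0 0) st \<and> ?F s st)"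
    proof (rule triple_conseq[OF triple_Skip])
      show "filling j (before (s + 1) 0 0 0) st \<and> ?F s st"
        if "(filling j (before s 0 0 0) st \<and> ?F s st) \<and> bval (Eq (Read ''r'' (sourceE kb)) (Const 0)) st" for st
      proof -
        have r0: "st ''r'' (addr j s) = 0" using that src[of "before s 0 0 0" st] by simp
        have "filling j (before (s + 1) 0 0 0) st"
          by (rule filling_mono[of j "before s 0 0 0" st]) (use that r0 in \<open>auto simp: before_def Opt_def\<close>)
        then show ?thesis using that by blast
      qed
    qed (auto simp: options_steps_def)
    show "triple m (\<lambda>st. (filling j (before s 0 0 0) st \<and> ?F s st) \<and> \<not> bval (Eq (Read ''r'' (sourceE kb)) (Const 0)) st)
       (options_prog kb sg) options_steps (\<lambda>st. filling j (before (s + 1) 0 0 0) st \<and> ?F s st)"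
      by (rule triple_conseq[OF options_triple[OF j s]]) (use src in auto)
  qed
  have loop: "triple m (\<lambda>st. filling j {} st \<and> st ''j'' 0 = int (Suc j))
     (For ''s'' (Const 0 \<ominus> radiusE kb) (radiusE kb)
       (Cond (Eq (Read ''r'' (sourceE kb)) (Const 0)) Skip (options_prog kb sg)))
     (2 + (2 * (n + 1) * (kb + kb * n + 1) + 1) * (options_steps + 3))
     (\<lambda>st. filling j (before (R + 1) 0 0 0) st \<and> st ''j'' 0 = int (Suc j))"
  proof (rule triple_For[where N = "Suc options_steps" and l = "- R" and h = R
      and J = "\<lambda>s st. filling j (before s 0 0 0) st \<and> st ''j'' 0 = int (Suc j)"])
    show "triple m (\<lambda>st. (filling j (before s 0 0 0) st \<and> st ''j'' 0 = int (Suc j)) \<and> st ''s'' 0 = s)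
     (Cond (Eq (Read ''r'' (sourceE kb)) (Const 0)) Skip (options_prog kb sg)) (Suc options_steps)
     (\<lambda>st. (filling j (before (s + 1) 0 0 0) st \<and> st ''j'' 0 = int (Suc j)) \<and> st ''s'' 0 = s)"
      if "- R \<le> s" "s \<le> R" for s
      by (rule triple_conseq[OF cell[of s]]) (use that in auto)
    show "filling j (before s 0 0 0) (update st ''s'' 0 y) \<and> update st ''s'' 0 y ''j'' 0 = int (Suc j)"
      if "filling j (before s 0 0 0) st \<and> st ''j'' 0 = int (Suc j)" for s st y
      using that by simp (simp add: update_def)
    show "aval (radiusE kb) st = R" if "filling j (before s 0 0 0) st \<and> st ''j'' 0 = int (Suc j)" for s st
      using that by (simp add: filling_def)
    show "aval (Const 0 \<ominus> radiusE kb) st = - R \<and> filling j (before (- R) 0 0 0) st \<and> st ''j'' 0 = int (Suc j)"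
      if "filling j {} st \<and> st ''j'' 0 = int (Suc j)" for st
    proof -
      have "aval (radiusE kb) st = R" using that by (simp add: filling_def)
      moreover have "filling j (before (- R) 0 0 0) st"
        by (rule filling_mono[of j "{}"]) (use that in \<open>auto simp: before_def Opt_def\<close>)
      ultimately show ?thesis using that by simp
    qed
    show "2 + nat (R + 1 - - R) * (Suc options_steps + 2) \<le> 2 + (2 * (n + 1) * (kb + kb * n + 1) + 1) * (options_steps + 3)"
      using arg_cong[of "Suc options_steps + 2" "options_steps + 3" "(*) (2 * (n + 1) * (kb + kb * n + 1) + 1)"]
      unfolding nat_R by linarith
    show "\<bar>- R\<bar> \<le> 2 ^ m" "\<bar>R + 1\<bar> \<le> 2 ^ m" "- R \<le> R + 1" using R_nonneg fits_bounds(4) by auto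
  qed auto
  have scale: "triple m (\<lambda>st. filling j (before (R + 1) 0 0 0) st \<and> st ''j'' 0 = int (Suc j))
      (Write ''D'' (Const 0) (scalar ''D'' \<otimes> cost_denE)) 1
      (\<lambda>st. filling (Suc j) {} st \<and> st ''j'' 0 = int (Suc j))"
  proof (rule triple_Write)
    fix st assume st: "filling j (before (R + 1) 0 0 0) st \<and> st ''j'' 0 = int (Suc j)"
    have "aval cost_denE st = den (Suc j)"
      by (rule aval_item[OF _ _ j1]) (use st in \<open>auto simp: filling_def\<close>)
    then have D: "aval (scalar ''D'' \<otimes> cost_denE) st = scale (Suc j)"
      using st by (simp add: filling_def scale_Suc)
    have "scale (Suc j) \<le> (2 ^ (5 * z)) ^ Suc j" by (rule scale_le) fact
    also have "\<dots> \<le> (2 ^ (5 * z)) ^ (2 * n)" using j by (intro power_increasing) auto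
    also have "\<dots> \<le> 2 ^ m" by (rule fits_bounds)
    finally have "\<bar>scale (Suc j)\<bar> \<le> 2 ^ m" using scale_pos[OF j1(2)] by simp
    moreover have "filling j UNIV st" by (rule filling_mono[of j "before (R + 1) 0 0 0"]) (use st in \<open>auto simp: before_def\<close>)
    then have "filling (Suc j) {} (update st ''D'' 0 (scale (Suc j)))"
      using table_next by (auto simp: filling_def update_def)
    ultimately show "\<bar>aval (scalar ''D'' \<otimes> cost_denE) st\<bar> \<le> 2 ^ m \<and>
      filling (Suc j) {} (update st ''D'' (aval (Const 0) st) (aval (scalar ''D'' \<otimes> cost_denE) st)) \<and>
      update st ''D'' (aval (Const 0) st) (aval (scalar ''D'' \<otimes> cost_denE) st) ''j'' 0 = int (Suc j)"
      using st unfolding D by (simp add: update_def)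
  qed
  show ?thesis
    unfolding layer_prog_def layer_steps_def by (rule triple_Seq[OF loop scale])
qed

definition start_store :: store where
  "start_store = (\<lambda>v. if v = ''in'' then inp else (\<lambda>_. 0))"

lemma table_triple:
  "triple m (\<lambda>st. st = start_store) (table_prog kb sg) (4 + n * (layer_steps + 2)) (filling n {})"
proof -
  have init: "triple m (\<lambda>st. st = start_store) (Write ''r'' (Const 0) (Const 1) ;; Write ''D'' (Const 0) (Const 1)) 2 (filling 0 {})"
  proof (rule triple_straight)
    fix st assume "st = start_store"
    moreover have "scale 0 = 1" by (simp add: scale_def)
    moreover have "1 \<le> (2::int) ^ m" by simp
    ultimately show "fits m (Write ''r'' (Const 0) (Const 1) ;; Write ''D'' (Const 0) (Const 1)) st \<and>
        filling 0 {} (run (Write ''r'' (Const 0) (Const 1) ;; Write ''D'' (Const 0) (Const 1)) st)"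
      using table_init[of "\<lambda>_. (0, 0, 0)"] by (simp add: filling_def update_def start_store_def)
  qed auto
  have loop: "triple m (filling 0 {}) (For ''j'' (Const 1) dimE (layer_prog kb sg))
      (2 + n * (layer_steps + 2)) (filling n {})"
  proof (rule triple_For[where N = layer_steps and l = 1 and h = "int n"
      and J = "\<lambda>i. filling (nat (i - 1)) {}"])
    fix i assume i: "1 \<le> i" "i \<le> int n"
    then have "i = int (Suc (nat (i - 1)))" by simp
    then obtain j where j: "i = int (Suc j)" by blast
    have "j < n" using i j by simp
    moreover have "nat (int (Suc j) - 1) = j" "nat (int (Suc j) + 1 - 1) = Suc j" by auto
    ultimately show "triple m (\<lambda>st. filling (nat (i - 1)) {} st \<and> st ''j'' 0 = i) (layer_prog kb sg) layer_steps
      (\<lambda>st. filling (nat (i + 1 - 1)) {} st \<and> st ''j'' 0 = i)"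
      using layer_triple[of j] unfolding j by simp
  next
    show "filling (nat (i - 1)) {} st \<Longrightarrow> aval dimE st = int n" for i st by (simp add: filling_def)
    show "\<bar>1\<bar> \<le> (2::int) ^ m" "\<bar>int n + 1\<bar> \<le> 2 ^ m" using fits_bounds(1) by auto
  qed auto
  have "triple m (\<lambda>st. st = start_store)
      ((Write ''r'' (Const 0) (Const 1) ;; Write ''D'' (Const 0) (Const 1)) ;;
        For ''j'' (Const 1) dimE (layer_prog kb sg)) (2 + (2 + n * (layer_steps + 2))) (filling n {})"
    by (rule triple_Seq[OF init loop])
  then show ?thesis
    unfolding table_prog_def by (rule triple_conseq) auto
qed

end

section \<open>Reading off a solution\<close>

definition backtrack_prog :: "nat \<Rightarrow> com" where
  "backtrack_prog kb =
     Write ''j'' (Const 0) (dimE \<oplus> Const 1 \<ominus> scalar ''i'') ;;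
     Write ''p'' (Const 0) (scalar ''j'' \<otimes> widthE kb \<oplus> scalar ''s'') ;;
     Write ''out'' (Const 1 \<oplus> scalar ''j'') (Read ''cx'' (scalar ''p'')) ;;
     Write ''out'' (dimE \<oplus> Const 2 \<oplus> Const 2 \<otimes> scalar ''j'')
       (flow_numE (Read ''ce'' (scalar ''p'')) (Read ''cc'' (scalar ''p''))) ;;
     Write ''out'' (dimE \<oplus> Const 3 \<oplus> Const 2 \<otimes> scalar ''j'') flow_denE ;;
     Write ''s'' (Const 0)
       (scalar ''s'' \<ominus> (unitE kb \<otimes> Read ''ce'' (scalar ''p'') \<oplus> Read ''cc'' (scalar ''p'')))"

definition header_prog :: com where
  "header_prog =
     Write ''out'' (Const 0) (Const 3 \<otimes> dimE \<oplus> Const 3) ;; Write ''out'' (Const 1) (Const 1) ;;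
     Write ''out'' (dimE \<oplus> Const 2) (Const 0) ;; Write ''out'' (dimE \<oplus> Const 3) (Const 1)"

text \<open>The target weight: \<open>H\<close> demands exactly one arc with \<open>e = 1\<close>, zero demands none.\<close>

definition goal_prog :: "nat \<Rightarrow> com" where
  "goal_prog kb = Cond (Eq demand_numE (Const 0)) (Write ''s'' (Const 0) (Const 0)) (Write ''s'' (Const 0) (unitE kb))"

definition output_prog :: "nat \<Rightarrow> com" where
  "output_prog kb =
     goal_prog kb ;;
     Cond (Eq (Read ''r'' (dimE \<otimes> widthE kb \<oplus> scalar ''s'')) (Const 0))
       (Write ''out'' (Const 0) (Const 1))
       (header_prog ;; For ''i'' (Const 1) dimE (backtrack_prog kb))"

definition flow_prog :: "nat \<Rightarrow> int \<Rightarrow> com" where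
  "flow_prog kb sg = table_prog kb sg ;; output_prog kb"

context flow_data
begin

definition T :: int where "T = (if dn = 0 then 0 else H)"

definition admissible :: "(nat \<Rightarrow> int \<times> int \<times> int) \<Rightarrow> bool" where
  "admissible os \<longleftrightarrow> (\<forall>i\<in>{1..n}. os i \<in> Opt i) \<and> (\<Sum>i=1..n. wt (os i)) = T"

text \<open>The length of the output, the mark for a feasible instance, and the flow \<open>0 / 1\<close> of arc 0.\<close>

definition header :: "(int \<Rightarrow> int) \<Rightarrow> bool" where
  "header out \<longleftrightarrow> out 0 = 3 * int n + 3 \<and> out 1 = 1 \<and> out (int n + 2) = 0 \<and> out (int n + 3) = 1"

text \<open>The part of the output for arc \<open>j\<close>: the value of \<open>x\<close> in the first block of the output, numerator and
  denominator of the flow in the second.  The second block starts with the pair for arc 0, which is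
  written by the header.\<close>

definition entry :: "(int \<Rightarrow> int) \<Rightarrow> nat \<Rightarrow> int \<times> int \<times> int \<Rightarrow> bool" where
  "entry out j o' \<longleftrightarrow> (case o' of (x, e, c) \<Rightarrow> out (1 + int j) = x \<and>
     out (int n + 2 + 2 * int j) = flow_num e c \<and> out (int n + 3 + 2 * int j) = fd * dd)"

definition answer :: "(int \<Rightarrow> int) \<Rightarrow> bool" where
  "answer out \<longleftrightarrow>
     (if \<exists>os. admissible os
      then \<exists>os. admissible os \<and> (\<forall>os'. admissible os' \<longrightarrow> (\<Sum>i=1..n. ratio i (os i)) \<le> (\<Sum>i=1..n. ratio i (os' i))) \<and>
        header out \<and> (\<forall>j\<in>{1..n}. entry out j (os j))
      else out 0 = 1 \<and> out 1 = 0)"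

definition tracking :: "nat \<Rightarrow> store \<Rightarrow> bool" where
  "tracking j st \<longleftrightarrow> st ''in'' = inp \<and>
     table n {} (st ''r'') (st ''v'') (\<lambda>p. (st ''cx'' p, st ''ce'' p, st ''cc'' p)) \<and> header (st ''out'') \<and>
     (\<exists>os. suffix_choice (st ''r'') (st ''v'') T j (st ''s'' 0) os \<and> (\<forall>i\<in>{j<..n}. entry (st ''out'') i (os i)))"

lemma T_bound: "\<bar>T\<bar> \<le> 2 ^ m" "\<bar>T\<bar> \<le> R"
proof -
  have H: "0 \<le> H" by (simp add: H_def)
  then show "\<bar>T\<bar> \<le> 2 ^ m" using fits_bounds(3) by (simp add: T_def)
  have "1 * (int kb + H) \<le> R" unfolding R_def using H by (intro mult_right_mono) auto
  then show "\<bar>T\<bar> \<le> R" using H by (auto simp: T_def)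
qed

text \<open>One step of backtracking extends the known suffix by the option recorded in the current cell.
  The entries of different arcs occupy different positions, by parity within the second block.\<close>

lemma backtrack_triple:
  assumes j: "j < n"
  shows "triple m (\<lambda>st. tracking (Suc j) st \<and> st ''i'' 0 = int n - int j) (backtrack_prog kb) 6
    (\<lambda>st. tracking j st \<and> st ''i'' 0 = int n - int j)"
proof (rule triple_straight)
  fix st assume P: "tracking (Suc j) st \<and> st ''i'' 0 = int n - int j"
  let ?ch = "\<lambda>p. (st ''cx'' p, st ''ce'' p, st ''cc'' p)"
  from P obtain os where inp: "st ''in'' = inp" and Tb: "table n {} (st ''r'') (st ''v'') ?ch"
    and head: "header (st ''out'')" and S: "suffix_choice (st ''r'') (st ''v'') T (Suc j) (st ''s'' 0) os"
    and E: "\<And>i. Suc j < i \<Longrightarrow> i \<le> n \<Longrightarrow> entry (st ''out'') i (os i)"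
    by (auto simp: tracking_def)
  define s where "s = st ''s'' 0"
  define p where "p = addr (Suc j) s"
  obtain x e c where xec: "st ''cx'' p = x" "st ''ce'' p = e" "st ''cc'' p = c" by blast
  \<comment> \<open>the option recorded in the cell \<open>(j + 1, s)\<close> joins the suffix\<close>
  define os' where "os' = os(Suc j := (x, e, c))"
  have "suffix_choice (st ''r'') (st ''v'') T (Suc j) s os'"
    unfolding s_def by (rule suffix_choice_cong[OF S]) (simp add: os'_def)
  then have S': "suffix_choice (st ''r'') (st ''v'') T j (s - wt (x, e, c)) os'"
    using suffix_choice_extend[OF Tb _ j, of T s os'] by (simp add: os'_def xec p_def[symmetric])
  then have "os' (Suc j) \<in> Opt (Suc j)" using j by (simp add: suffix_choice_def)
  then have o: "(x, e, c) \<in> Opt (Suc j)" by (simp add: os'_def)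
  have j1: "1 \<le> Suc j" "Suc j \<le> n" using j by auto
  note ob = Opt_bound[OF j1 o]
  have sR: "\<bar>s\<bar> \<le> R" "\<bar>s - wt (x, e, c)\<bar> \<le> R" using S S' by (auto simp: suffix_choice_def s_def)
  have W0: "0 \<le> W" using R_nonneg by (simp add: W_def)
  have "0 \<le> int (Suc j) * W" using W0 by simp
  then have "\<bar>p\<bar> \<le> int (Suc j) * W + R"
    using sR unfolding p_def addr_def by linarith
  also have "\<dots> \<le> int n * W + R" using j1 W0 by (intro add_right_mono mult_right_mono) auto
  also have "\<dots> \<le> 2 ^ m" by (rule fits_bounds)
  finally have pb: "\<bar>p\<bar> \<le> 2 ^ m" .
  have fb: "\<bar>flow_num e c\<bar> \<le> 2 ^ m" "\<bar>fd * dd\<bar> \<le> 2 ^ m" "\<bar>x\<bar> \<le> 2 ^ m"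
      "\<bar>s - wt (x, e, c)\<bar> \<le> 2 ^ m" "\<bar>1 + int j\<bar> \<le> 2 ^ m"
    using flow_num_bound[of e c] flow_den_bound ob fits_bounds(1,4,9,10,11) sR j by linarith+
  let ?o1 = "(st ''out'')(2 + int j := x)"
  let ?o2 = "?o1(int n + 2 + 2 * (1 + int j) := flow_num e c)"
  let ?o3 = "?o2(int n + 3 + 2 * (1 + int j) := fd * dd)"
  let ?st1 = "update (update st ''j'' 0 (1 + int j)) ''p'' 0 p"
  let ?st2 = "update (update (update ?st1 ''out'' (2 + int j) x) ''out'' (int n + 2 + 2 * (1 + int j)) (flow_num e c))
    ''out'' (int n + 3 + 2 * (1 + int j)) (fd * dd)"
  let ?st3 = "update ?st2 ''s'' 0 (s - wt (x, e, c))"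
  have p: "(1 + int j) * W + s = p" by (simp add: p_def addr_def)
  have run: "run (backtrack_prog kb) st = ?st3" and fits: "fits m (backtrack_prog kb) st"
    using P inp fb pb by (simp_all add: backtrack_prog_def update_def p xec s_def[symmetric])
  have "header ?o3" using head j by (auto simp: header_def)
  moreover have "entry ?o3 i (os' i)" if "j < i" "i \<le> n" for i
  proof (cases "i = Suc j")
    case True
    then show ?thesis using j by (auto simp: entry_def os'_def)
  next
    case False
    then have i: "Suc j < i" using that by simp
    have "2 * int i + 1 \<noteq> 2 * (1 + int j)" "2 * int i \<noteq> 2 * (1 + int j) + 1" by presburger+
    then have "?o3 (1 + int i) = st ''out'' (1 + int i)"
      "?o3 (int n + 2 + 2 * int i) = st ''out'' (int n + 2 + 2 * int i)"
      "?o3 (int n + 3 + 2 * int i) = st ''out'' (int n + 3 + 2 * int i)"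
      using i that j by (auto simp: fun_upd_def)
    then show ?thesis using E[OF i that(2)] i by (simp add: entry_def os'_def split: prod.splits)
  qed
  moreover have "?st3 ''out'' = ?o3" "?st3 ''in'' = inp" "?st3 ''s'' 0 = s - wt (x, e, c)"
    "?st3 ''i'' = st ''i''" "?st3 ''r'' = st ''r''" "?st3 ''v'' = st ''v''"
    "?st3 ''cx'' = st ''cx''" "?st3 ''ce'' = st ''ce''" "?st3 ''cc'' = st ''cc''"
    using inp by (auto simp: update_def)
  ultimately show "fits m (backtrack_prog kb) st \<and>
      (tracking j (run (backtrack_prog kb) st) \<and> run (backtrack_prog kb) st ''i'' 0 = int n - int j)"
    using fits S' Tb P unfolding run tracking_def by auto
qed (simp_all add: backtrack_prog_def)

lemma header_triple:
  "triple m (\<lambda>st. filling n {} st \<and> st ''s'' 0 = T \<and> st ''r'' (addr n T) \<noteq> 0) header_prog 4 (tracking n)"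
proof (rule triple_straight)
  fix st assume P: "filling n {} st \<and> st ''s'' 0 = T \<and> st ''r'' (addr n T) \<noteq> 0"
  then have "suffix_choice (st ''r'') (st ''v'') T n T (\<lambda>_. (0, 0, 0))"
    using T_bound(2) by (simp add: suffix_choice_def)
  moreover have "\<bar>3 * int n + 3\<bar> \<le> 2 ^ m" using fits_bounds(8) by simp
  ultimately show "fits m header_prog st \<and> tracking n (run header_prog st)"
    using P by (auto simp: header_prog_def tracking_def filling_def update_def header_def)
qed (simp_all add: header_prog_def)

lemma tracking_answer:
  assumes "tracking 0 st"
  shows "answer (st ''out'')"
proof -
  let ?ch = "\<lambda>p. (st ''cx'' p, st ''ce'' p, st ''cc'' p)"
  from assms obtain os where Tb: "table n {} (st ''r'') (st ''v'') ?ch" and head: "header (st ''out'')"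
    and S: "suffix_choice (st ''r'') (st ''v'') T 0 (st ''s'' 0) os"
    and E: "\<forall>i\<in>{0<..n}. entry (st ''out'') i (os i)"
    by (auto simp: tracking_def)
  note C = suffix_choice_complete[OF Tb S]
  then have adm: "admissible os" by (simp add: admissible_def)
  have "(\<Sum>i=1..n. ratio i (os i)) \<le> (\<Sum>i=1..n. ratio i (os' i))" if "admissible os'" for os'
    using table_optimal[OF Tb order_refl, of os'] that C by (simp add: admissible_def)
  moreover have "\<forall>i\<in>{1..n}. entry (st ''out'') i (os i)" using E by simp
  moreover have "\<exists>os. admissible os" using adm by blast
  ultimately show ?thesis unfolding answer_def using adm head by auto
qed

lemma unreached_answer:
  assumes Tb: "table n {} r v ch" and "r (addr n T) = 0" and "out 0 = 1" "out 1 = 0"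
  shows "answer out"
proof -
  have "\<not> admissible os" for os
    using table_optimal[OF Tb order_refl, of os] assms(2) by (auto simp: admissible_def)
  then show ?thesis using assms(3,4) by (simp add: answer_def)
qed

lemma output_triple:
  "triple m (filling n {}) (output_prog kb) (9 + 8 * n) (\<lambda>st. answer (st ''out''))"
proof -
  have goal: "triple m (filling n {}) (goal_prog kb) 2 (\<lambda>st. filling n {} st \<and> st ''s'' 0 = T)"
  proof (rule triple_straight)
    fix st assume P: "filling n {} st"
    then have inp: "st ''in'' = inp" by (simp add: filling_def)
    have "aval demand_numE st = dn" "aval (unitE kb) st = H" using inp by simp_all
    moreover have "\<bar>H\<bar> \<le> 2 ^ m" "\<bar>0\<bar> \<le> (2::int) ^ m"
      using fits_bounds(3) by (simp_all add: H_def)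
    ultimately have "fits m (goal_prog kb) st" "run (goal_prog kb) st = update st ''s'' 0 T"
      unfolding goal_prog_def T_def by (simp_all only: fits.simps run.simps bval.simps aval.simps split: if_split) auto
    moreover have "update st ''s'' 0 T ''s'' 0 = T" by (simp add: update_def)
    ultimately show "fits m (goal_prog kb) st \<and> filling n {} (run (goal_prog kb) st) \<and> run (goal_prog kb) st ''s'' 0 = T"
      using P by simp
  qed (simp_all add: goal_prog_def)
  have reached: "bval (Eq (Read ''r'' (dimE \<otimes> widthE kb \<oplus> scalar ''s'')) (Const 0)) st \<longleftrightarrow>
      st ''r'' (addr n T) = 0" if "filling n {} st \<and> st ''s'' 0 = T" for st
  proof -
    have "st ''in'' = inp" using that unfolding filling_def by blast
    then have "aval dimE st = int n" "aval (widthE kb) st = W" by simp_all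
    then show ?thesis using that by (simp only: bval.simps aval.simps addr_def)
  qed
  have none: "triple m (\<lambda>st. (filling n {} st \<and> st ''s'' 0 = T) \<and>
        bval (Eq (Read ''r'' (dimE \<otimes> widthE kb \<oplus> scalar ''s'')) (Const 0)) st)
      (Write ''out'' (Const 0) (Const 1)) (6 + 8 * n) (\<lambda>st. answer (st ''out''))"
  proof (rule triple_straight)
    fix st assume P: "(filling n {} st \<and> st ''s'' 0 = T) \<and>
        bval (Eq (Read ''r'' (dimE \<otimes> widthE kb \<oplus> scalar ''s'')) (Const 0)) st"
    then have "st ''r'' (addr n T) = 0" using reached[of st] by blast
    moreover have "table n {} (st ''r'') (st ''v'') (\<lambda>p. (st ''cx'' p, st ''ce'' p, st ''cc'' p))"
      "st ''out'' = (\<lambda>_. 0)" using P by (auto simp: filling_def)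
    ultimately show "fits m (Write ''out'' (Const 0) (Const 1)) st \<and>
        answer (run (Write ''out'' (Const 0) (Const 1)) st ''out'')"
      by (auto simp: update_def intro!: unreached_answer)
  qed auto
  have loop: "triple m (tracking n) (For ''i'' (Const 1) dimE (backtrack_prog kb)) (2 + 8 * n)
      (\<lambda>st. answer (st ''out''))"
  proof (rule triple_For[where N = 6 and l = 1 and h = "int n" and J = "\<lambda>i. tracking (nat (int n + 1 - i))"])
    fix i assume i: "1 \<le> i" "i \<le> int n"
    then have "i = int n - int (nat (int n - i))" by simp
    then obtain j where j: "i = int n - int j" by blast
    have "j < n" using i j by simp
    moreover have "nat (int n + 1 - (int n - int j)) = Suc j" "nat (int n + 1 - (int n - int j + 1)) = j" by auto
    ultimately show "triple m (\<lambda>st. tracking (nat (int n + 1 - i)) st \<and> st ''i'' 0 = i) (backtrack_prog kb) 6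
      (\<lambda>st. tracking (nat (int n + 1 - (i + 1))) st \<and> st ''i'' 0 = i)"
      using backtrack_triple[of j] unfolding j by simp
  next
    show "tracking (nat (int n + 1 - i)) (update st ''i'' 0 y)" if "tracking (nat (int n + 1 - i)) st" for i st y
      using that by (simp add: tracking_def update_def)
    show "aval dimE st = int n" if "tracking (nat (int n + 1 - i)) st" for i st
      using that by (simp add: tracking_def)
    show "\<bar>1\<bar> \<le> (2::int) ^ m" "\<bar>int n + 1\<bar> \<le> 2 ^ m" using fits_bounds(1) by auto
    show "answer (st ''out'')" if "tracking (nat (int n + 1 - (int n + 1))) st" for st
      using that by (simp add: tracking_answer)
  qed auto
  have some: "triple m (\<lambda>st. (filling n {} st \<and> st ''s'' 0 = T) \<and>
        \<not> bval (Eq (Read ''r'' (dimE \<otimes> widthE kb \<oplus> scalar ''s'')) (Const 0)) st)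
      (header_prog ;; For ''i'' (Const 1) dimE (backtrack_prog kb)) (6 + 8 * n) (\<lambda>st. answer (st ''out''))"
    by (rule triple_conseq[OF triple_Seq[OF header_triple loop]]) (use reached in auto)
  show ?thesis
    unfolding output_prog_def
    by (rule triple_conseq[OF triple_Seq[OF goal triple_Cond[OF none some]]]) auto
qed

definition flow_steps :: nat where "flow_steps = 13 + 8 * n + n * (layer_steps + 2)"

theorem flow_prog_correct:
  "\<exists>t s. exec (flow_prog kb sg) start_store t s \<and>
     t \<le> flow_steps * (coef (flow_prog kb sg) * (m + 2)) \<and> answer (s ''out'')"
proof -
  have "triple m (\<lambda>st. st = start_store) (flow_prog kb sg) (4 + n * (layer_steps + 2) + (9 + 8 * n))
      (\<lambda>st. answer (st ''out''))"
    unfolding flow_prog_def by (rule triple_Seq[OF table_triple output_triple])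
  moreover have "small m start_store"
  proof -
    have "l \<le> m" by (simp add: m_def z_def)
    then have "(2::int) ^ l \<le> 2 ^ m" by (intro power_increasing) auto
    then have "\<bar>inp i\<bar> \<le> 2 ^ m" for i using inp_le[of i] by linarith
    then show ?thesis by (simp add: small_def start_store_def)
  qed
  moreover have "4 + n * (layer_steps + 2) + (9 + 8 * n) = flow_steps" by (simp add: flow_steps_def)
  ultimately show ?thesis unfolding triple_def by metis
qed

end

section \<open>A polynomial time bound\<close>

text \<open>The step count times the cost unit, with the bit size \<open>L\<close> of the input in place of the dimension.\<close>

definition time_bound :: "nat \<Rightarrow> int \<Rightarrow> nat \<Rightarrow> nat" where
  "time_bound kb sg L =
     (13 + 8 * L + L * ((2 + (2 * (L + 1) * (kb + kb * L + 1) + 1) *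
       ((2 + 2 * (2 + 2 * (2 + (2 * kb + 1) * 10 + 2) + 2)) + 3) + 1) + 2)) *
     (coef (flow_prog kb sg) * (10 * (kb + 3 + L) * (L + 1) + 2))"

lemma poly_closure:
  fixes g h :: "nat \<Rightarrow> nat"
  shows "\<exists>p. \<forall>x. c = poly p (x :: nat)" "\<exists>p. \<forall>x. x = poly p (x :: nat)"
    "\<exists>p. \<forall>x. g x = poly p x \<Longrightarrow> \<exists>p. \<forall>x. h x = poly p x \<Longrightarrow> \<exists>p. \<forall>x. g x + h x = poly p x"
    "\<exists>p. \<forall>x. g x = poly p x \<Longrightarrow> \<exists>p. \<forall>x. h x = poly p x \<Longrightarrow> \<exists>p. \<forall>x. g x * h x = poly p x"
proof -
  show "\<exists>p. \<forall>x. c = poly p (x :: nat)" by (rule exI[of _ "[:c:]"]) simp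
  show "\<exists>p. \<forall>x. x = poly p (x :: nat)" by (rule exI[of _ "[:0, 1:]"]) simp
  assume "\<exists>p. \<forall>x. g x = poly p x" "\<exists>p. \<forall>x. h x = poly p x"
  then obtain p q where pq: "\<forall>x. g x = poly p x" "\<forall>x. h x = poly q x" by blast
  show "\<exists>p. \<forall>x. g x + h x = poly p x" by (rule exI[of _ "p + q"]) (simp add: pq)
  show "\<exists>p. \<forall>x. g x * h x = poly p x" by (rule exI[of _ "p * q"]) (simp add: pq)
qed

lemma time_bound_poly: "\<exists>p. \<forall>L. time_bound kb sg L = poly p L"
  unfolding time_bound_def by (intro poly_closure)

lemma (in flow_data) flow_time:
  assumes "n \<le> l"
  shows "flow_steps * (coef (flow_prog kb sg) * (m + 2)) \<le> time_bound kb sg l"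
  unfolding flow_steps_def layer_steps_def options_steps_def m_def z_def time_bound_def
  by (intro mult_le_mono add_le_mono order_refl assms)

section \<open>The encoding of instances\<close>

lemma concat_pairs:
  "length (concat (map (\<lambda>u. [f u, g u]) us)) = 2 * length us"
  "j < length us \<Longrightarrow> concat (map (\<lambda>u. [f u, g u]) us) ! (2 * j) = f (us ! j)"
  "j < length us \<Longrightarrow> concat (map (\<lambda>u. [f u, g u]) us) ! (2 * j + 1) = g (us ! j)"
proof -
  show "length (concat (map (\<lambda>u. [f u, g u]) us)) = 2 * length us" by (induction us) auto
  show "j < length us \<Longrightarrow> concat (map (\<lambda>u. [f u, g u]) us) ! (2 * j) = f (us ! j)"
    by (induction us arbitrary: j) (auto simp: nth_Cons split: nat.split)
  show "j < length us \<Longrightarrow> concat (map (\<lambda>u. [f u, g u]) us) ! (2 * j + 1) = g (us ! j)"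
    by (induction us arbitrary: j) (auto simp: nth_Cons split: nat.split)
qed

lemma length_le_bit_size: "length xs \<le> bit_size xs"
  unfolding bit_size_def using bits_pos by (induction xs) (auto simp: Suc_le_eq add_strict_increasing intro: add_mono[of 1, simplified])

lemma initial_store_le: "\<bar>initial_store xs ''in'' i\<bar> \<le> 2 ^ bit_size xs"
proof -
  have p: "int k < 2 ^ k" for k by (rule of_nat_less_two_power)
  have "\<bar>y\<bar> \<le> 2 ^ bit_size xs" if "y \<in> set xs" for y
  proof -
    have "bits y \<le> bit_size xs"
      unfolding bit_size_def by (rule member_le_sum_list) (use that in auto)
    then have "(2::int) ^ (bits y - 1) \<le> 2 ^ bit_size xs" by (intro power_increasing) auto
    then show ?thesis using bits_less[of y] by linarith
  qed
  moreover have "\<bar>int (length xs)\<bar> \<le> 2 ^ bit_size xs"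
    using p[of "bit_size xs"] length_le_bit_size[of xs] by linarith
  ultimately have *: "\<bar>y\<bar> \<le> 2 ^ bit_size xs" if "y \<in> set (int (length xs) # xs)" for y
    using that by auto
  show ?thesis
  proof (cases "0 \<le> i \<and> i \<le> int (length xs)")
    case True
    then have "(int (length xs) # xs) ! nat i \<in> set (int (length xs) # xs)" by (intro nth_mem) auto
    with * show ?thesis using True by (simp add: initial_store_def del: set_simps)
  next
    case False
    then show ?thesis by (auto simp: initial_store_def)
  qed
qed

lemma initial_store_nth:
  "i < length xs \<Longrightarrow> initial_store xs ''in'' (int i + 1) = xs ! i"
  by (simp add: initial_store_def nat_add_distrib)

definition sgn_of :: "sense \<Rightarrow> int" where
  "sgn_of s = (case s of Minimize \<Rightarrow> 1 | Maximize \<Rightarrow> - 1)"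

text \<open>The positions in the input array at which the program expects the data of the instance.\<close>

lemma encode_layout:
  fixes I :: flow_instance
  defines "inp \<equiv> initial_store (encode_instance I) ''in''" and "n \<equiv> dim I"
  shows "length (encode_instance I) = 5 * n + 7"
    and "inp 1 = int n"
    and "1 \<le> j \<Longrightarrow> j \<le> n \<Longrightarrow> inp (int j + 1) = int (kappa I j)"
    and "inp (int n + 2) = fst (quotient_of (fbar I))" "inp (int n + 3) = snd (quotient_of (fbar I))"
    and "inp (int n + 4) = fst (quotient_of (demand I))" "inp (int n + 5) = snd (quotient_of (demand I))"
    and "1 \<le> j \<Longrightarrow> j \<le> n \<Longrightarrow> inp (int n + 4 + 2 * int j) = fst (quotient_of (coeff_x I j))"
    and "1 \<le> j \<Longrightarrow> j \<le> n \<Longrightarrow> inp (int n + 5 + 2 * int j) = snd (quotient_of (coeff_x I j))"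
    and "j \<le> n \<Longrightarrow> inp (3 * int n + 6 + 2 * int j) = fst (quotient_of (coeff_f I j))"
    and "j \<le> n \<Longrightarrow> inp (3 * int n + 7 + 2 * int j) = snd (quotient_of (coeff_f I j))"
proof -
  let ?A = "map (\<lambda>j. int (kappa I j)) [1..<Suc n]"
  let ?F = "encode_rat (fbar I)" and ?D = "encode_rat (demand I)"
  let ?X = "concat (map (\<lambda>j. encode_rat (coeff_x I j)) [1..<Suc n])"
  let ?Y = "concat (map (\<lambda>j. encode_rat (coeff_f I j)) [0..<Suc n])"
  have enc: "encode_instance I = [int n] @ ?A @ ?F @ ?D @ ?X @ ?Y"
    by (simp only: encode_instance_def n_def)
  have len: "length ?A = n" "length ?F = 2" "length ?D = 2" "length ?X = 2 * n" "length ?Y = 2 * (n + 1)"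
    by (simp_all add: encode_rat_def concat_pairs(1) del: upt_Suc)
  show L: "length (encode_instance I) = 5 * n + 7" unfolding enc length_append len by simp
  have at: "inp (int (length us + i) + 1) = vs ! i"
    if "encode_instance I = us @ vs @ ws" "i < length vs" for us vs ws i
    using that initial_store_nth[of "length us + i" "encode_instance I"]
    by (simp add: inp_def nth_append)
  show "inp 1 = int n" using at[of "[]" "[int n]" "?A @ ?F @ ?D @ ?X @ ?Y" 0] enc by simp
  show "inp (int j + 1) = int (kappa I j)" if "1 \<le> j" "j \<le> n"
    using at[of "[int n]" ?A "?F @ ?D @ ?X @ ?Y" "j - 1"] enc len that
    by (simp add: nth_append del: upt_Suc)
  have F: "inp (int (1 + n + i) + 1) = ?F ! i" if "i < 2" for i
    using at[of "[int n] @ ?A" ?F "?D @ ?X @ ?Y" i] enc len that by (simp del: upt_Suc)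
  show "inp (int n + 2) = fst (quotient_of (fbar I))" using F[of 0] by (simp add: encode_rat_def add.commute)
  show "inp (int n + 3) = snd (quotient_of (fbar I))" using F[of 1] by (simp add: encode_rat_def add.commute)
  have D: "inp (int (3 + n + i) + 1) = ?D ! i" if "i < 2" for i
    using at[of "[int n] @ ?A @ ?F" ?D "?X @ ?Y" i] enc len that by (simp del: upt_Suc)
  show "inp (int n + 4) = fst (quotient_of (demand I))" using D[of 0] by (simp add: encode_rat_def add.commute)
  show "inp (int n + 5) = snd (quotient_of (demand I))" using D[of 1] by (simp add: encode_rat_def add.commute)
  have X: "inp (int (5 + n + i) + 1) = ?X ! i" if "i < 2 * n" for i
    using at[of "[int n] @ ?A @ ?F @ ?D" ?X "?Y" i] enc len that by (simp del: upt_Suc)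
  have Y: "inp (int (5 + 3 * n + i) + 1) = ?Y ! i" if "i < 2 * (n + 1)" for i
    using at[of "[int n] @ ?A @ ?F @ ?D @ ?X" ?Y "[]" i] enc len that by (simp del: upt_Suc)
  have Xn: "?X ! (2 * i) = fst (quotient_of (coeff_x I (Suc i)))"
    "?X ! (2 * i + 1) = snd (quotient_of (coeff_x I (Suc i)))" if "i < n" for i
    unfolding encode_rat_def by (subst concat_pairs; use that in \<open>simp del: upt_Suc\<close>)+
  have Yn: "?Y ! (2 * i) = fst (quotient_of (coeff_f I i))"
    "?Y ! (2 * i + 1) = snd (quotient_of (coeff_f I i))" if "i \<le> n" for i
    unfolding encode_rat_def by (subst concat_pairs; use that in \<open>simp del: upt_Suc\<close>)+
  show "inp (int n + 4 + 2 * int j) = fst (quotient_of (coeff_x I j))"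
    "inp (int n + 5 + 2 * int j) = snd (quotient_of (coeff_x I j))" if "1 \<le> j" "j \<le> n"
  proof -
    obtain i where i: "j = Suc i" "i < n" using \<open>1 \<le> j\<close> \<open>j \<le> n\<close> by (cases j) auto
    have "int (5 + n + 2 * i) + 1 = int n + 4 + 2 * int j" "int (5 + n + (2 * i + 1)) + 1 = int n + 5 + 2 * int j"
      using i by auto
    then show "inp (int n + 4 + 2 * int j) = fst (quotient_of (coeff_x I j))"
      "inp (int n + 5 + 2 * int j) = snd (quotient_of (coeff_x I j))"
      using X[of "2 * i"] X[of "2 * i + 1"] Xn[OF i(2)] i by auto
  qed
  show "inp (3 * int n + 6 + 2 * int j) = fst (quotient_of (coeff_f I j))"
    "inp (3 * int n + 7 + 2 * int j) = snd (quotient_of (coeff_f I j))" if "j \<le> n"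
  proof -
    have eq: "int (5 + 3 * n + 2 * j) + 1 = 3 * int n + 6 + 2 * int j" "int (5 + 3 * n + (2 * j + 1)) + 1 = 3 * int n + 7 + 2 * int j"
      by auto
    have "2 * j < 2 * (n + 1)" "2 * j + 1 < 2 * (n + 1)" using \<open>j \<le> n\<close> by auto
    from this[THEN Y] show "inp (3 * int n + 6 + 2 * int j) = fst (quotient_of (coeff_f I j))"
      "inp (3 * int n + 7 + 2 * int j) = snd (quotient_of (coeff_f I j))"
      unfolding eq Yn[OF \<open>j \<le> n\<close>] by this
  qed
qed

section \<open>Selections and feasible points\<close>

lemma quotient_real: "of_rat r = (of_int (fst (quotient_of r)) / of_int (snd (quotient_of r)) :: real)"
proof -
  have "r = of_int (fst (quotient_of r)) / of_int (snd (quotient_of r))"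
    by (rule quotient_of_div) simp
  then have "of_rat r = (of_rat (of_int (fst (quotient_of r)) / of_int (snd (quotient_of r))) :: real)"
    by (rule arg_cong)
  then show ?thesis by (simp add: of_rat_divide)
qed

locale encoded_instance =
  fixes kbar :: nat and I :: flow_instance and sense :: sense
  assumes I: "I \<in> flow_instances kbar"
begin

abbreviation "n \<equiv> dim I"
abbreviation "F \<equiv> (of_rat (fbar I) :: real)"
abbreviation "d \<equiv> (of_rat (demand I) :: real)"
abbreviation "sg \<equiv> sgn_of sense"

sublocale flow_data n kbar "\<lambda>j. int (kappa I j)" "fst (quotient_of (fbar I))" "snd (quotient_of (fbar I))"
  "fst (quotient_of (demand I))" "snd (quotient_of (demand I))"
  "\<lambda>j. fst (quotient_of (coeff_x I j))" "\<lambda>j. snd (quotient_of (coeff_x I j))"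
  "\<lambda>j. fst (quotient_of (coeff_f I j))" "\<lambda>j. snd (quotient_of (coeff_f I j))"
  sg "initial_store (encode_instance I) ''in''" "bit_size (encode_instance I)"
proof
  show "\<bar>initial_store (encode_instance I) ''in'' i\<bar> \<le> 2 ^ bit_size (encode_instance I)" for i
    by (rule initial_store_le)
  show "\<bar>sg\<bar> = 1" by (simp add: sgn_of_def split: sense.split)
  show "int (kappa I j) \<le> int kbar" if "1 \<le> j" "j \<le> n" for j
    using I that by (auto simp: flow_instances_def)
qed (use encode_layout in \<open>auto simp: quotient_of_denom_pos'\<close>)

lemma F_pos: "0 < F" and d_range: "0 \<le> d" "d < F"
  using I by (auto simp: flow_instances_def zero_le_of_rat_iff of_rat_less)

lemma demand_zero_iff: "fst (quotient_of (demand I)) = 0 \<longleftrightarrow> d = 0"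
  using quotient_of_denom_pos'[of "demand I"] unfolding quotient_real[of "demand I"] by simp

lemma flow_real:
  "of_int (flow_num e c) / of_int (snd (quotient_of (fbar I)) * snd (quotient_of (demand I))) =
     of_int c * F + of_int e * d"
  using quotient_of_denom_pos'[of "demand I"] quotient_of_denom_pos'[of "fbar I"]
  unfolding quotient_real flow_num_def by (simp add: field_simps)

lemma ratio_real:
  "ratio j (x, e, c) = of_int sg * (of_rat (coeff_x I j) * of_int x +
     of_rat (coeff_f I j) * (of_int c * F + of_int e * d))"
  using quotient_of_denom_pos'[of "demand I"] quotient_of_denom_pos'[of "fbar I"]
    quotient_of_denom_pos'[of "coeff_x I j"] quotient_of_denom_pos'[of "coeff_f I j"]
  unfolding flow_real[symmetric] unfolding quotient_real ratio_def
  by (simp add: den_def field_simps)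

definition solution :: "(nat \<Rightarrow> int \<times> int \<times> int) \<Rightarrow> (nat \<Rightarrow> real) \<times> (nat \<Rightarrow> real)" where
  "solution os = (\<lambda>j\<in>{1..n}. of_int (fst (os j)),
     \<lambda>j\<in>{0..n}. if j = 0 then 0 else of_int (snd (snd (os j))) * F + of_int (fst (snd (os j))) * d)"

lemma sum_from_0: "(\<Sum>j=0..n. g j) = g 0 + (\<Sum>j=1..n. g j)" for g :: "nat \<Rightarrow> real"
  by (simp add: sum.atLeast_Suc_atMost)

lemma objective_ratio:
  "of_int sg * instance_objective I (solution os) = (\<Sum>j=1..n. ratio j (os j))"
proof -
  have "of_int sg * instance_objective I (solution os) =
    of_int sg * ((\<Sum>j=1..n. of_rat (coeff_x I j) * of_int (fst (os j))) +
      (\<Sum>j=1..n. of_rat (coeff_f I j) * (of_int (snd (snd (os j))) * F + of_int (fst (snd (os j))) * d)))"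
    by (simp add: instance_objective_def linear_objective_def solution_def sum_from_0)
  also have "\<dots> = (\<Sum>j=1..n. ratio j (os j))"
    unfolding sum.distrib[symmetric] sum_distrib_left
  proof (rule sum.cong)
    fix j
    show "of_int sg * (of_rat (coeff_x I j) * of_int (fst (os j)) +
        of_rat (coeff_f I j) * (of_int (snd (snd (os j))) * F + of_int (fst (snd (os j))) * d)) = ratio j (os j)"
      by (cases "os j") (simp add: ratio_real)
  qed simp
  finally show ?thesis .
qed

text \<open>The weight of a selection determines the sums of its \<open>e\<close> and \<open>c\<close> separately, since the \<open>c\<close> sum
  to less than the weight unit \<open>H\<close> in absolute value.\<close>

lemma weight_sum:
  assumes "\<And>j. 1 \<le> j \<Longrightarrow> j \<le> n \<Longrightarrow> os j \<in> Opt j"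
  shows "(\<Sum>j=1..n. wt (os j)) = T \<longleftrightarrow>
    (\<Sum>j=1..n. snd (snd (os j))) = 0 \<and> (\<Sum>j=1..n. fst (snd (os j))) = (if d = 0 then 0 else 1)"
proof -
  let ?c = "\<Sum>j=1..n. snd (snd (os j))" and ?e = "\<Sum>j=1..n. fst (snd (os j))"
  let ?t = "if d = 0 then 0 else 1 :: int"
  have w: "wt (os j) = H * fst (snd (os j)) + snd (snd (os j))" for j by (cases "os j") simp
  have sum: "(\<Sum>j=1..n. wt (os j)) = H * ?e + ?c" by (simp add: w sum.distrib sum_distrib_left)
  have "\<bar>?c\<bar> \<le> (\<Sum>j=1..n. int kbar)"
  proof (rule order_trans[OF sum_abs sum_mono])
    fix j assume "j \<in> {1..n}"
    then show "\<bar>snd (snd (os j))\<bar> \<le> int kbar"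
      using Opt_bound(6)[of j "fst (os j)" "fst (snd (os j))" "snd (snd (os j))"] assms[of j] by simp
  qed
  then have c: "\<bar>?c\<bar> < H" by (simp add: H_def mult.commute)
  have T: "T = H * ?t" by (simp add: T_def demand_zero_iff)
  show ?thesis
  proof
    assume "(\<Sum>j=1..n. wt (os j)) = T"
    then have eq: "?c = H * (?t - ?e)" unfolding sum T by (simp add: algebra_simps)
    have "?t - ?e = 0"
    proof (rule ccontr)
      assume "?t - ?e \<noteq> 0"
      then have "H * 1 \<le> H * \<bar>?t - ?e\<bar>" by (intro mult_left_mono) (auto simp: H_def)
      moreover have "\<bar>?c\<bar> = H * \<bar>?t - ?e\<bar>" unfolding eq abs_mult by (simp add: H_def)
      ultimately show False using c by linarith
    qed
    then show "?c = 0 \<and> ?e = ?t" using eq by simp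
  next
    assume "?c = 0 \<and> ?e = ?t"
    then show "(\<Sum>j=1..n. wt (os j)) = T" unfolding sum T by simp
  qed
qed

text \<open>Selections of the right weight are feasible flows, and by \<open>objective_ratio\<close> at the same cost.\<close>

lemma admissible_feasible:
  assumes "admissible os"
  shows "solution os \<in> instance_feasible I"
proof -
  have opt: "os j \<in> Opt j" if "1 \<le> j" "j \<le> n" for j using assms that by (simp add: admissible_def)
  have sums: "(\<Sum>j=1..n. snd (snd (os j))) = 0" "(\<Sum>j=1..n. fst (snd (os j))) = (if d = 0 then 0 else 1)"
    using weight_sum[OF opt] assms by (auto simp: admissible_def)
  define f where "f j = of_int (snd (snd (os j))) * F + of_int (fst (snd (os j))) * d" for j
  have "(\<Sum>j=1..n. f j) = of_int (\<Sum>j=1..n. snd (snd (os j))) * F + of_int (\<Sum>j=1..n. fst (snd (os j))) * d"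
    by (simp add: f_def sum.distrib sum_distrib_right)
  also have "\<dots> = d" unfolding sums by simp
  finally have "(\<Sum>j=0..n. snd (solution os) j) = d"
    by (simp add: solution_def sum_from_0 f_def)
  moreover have "real_of_int (fst (os j)) \<in> {0, 1} \<and>
      - (real (kappa I j) * F) * of_int (fst (os j)) \<le> f j \<and> f j \<le> real (kappa I j) * F * of_int (fst (os j))"
    if "1 \<le> j" "j \<le> n" for j
  proof -
    obtain x e c where xec: "os j = (x, e, c)" by (cases "os j")
    have o: "(x, e, c) \<in> Opt j" using opt[OF that] xec by simp
    note b = Opt_bound[OF that o]
    have c: "- (int (kappa I j) * x) \<le> c" "c + e \<le> int (kappa I j) * x" using o by (auto simp: Opt_def)
    have "of_int (- (int (kappa I j) * x)) * F \<le> of_int c * F" using c(1) F_pos by (intro mult_right_mono) (simp_all only: of_int_le_iff less_imp_le)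
    moreover have "0 \<le> of_int e * d" using b d_range by simp
    ultimately have lo: "- (real (kappa I j) * F) * of_int x \<le> f j" by (simp add: f_def xec algebra_simps)
    have "of_int (c + e) * F \<le> of_int (int (kappa I j) * x) * F" using c(2) F_pos by (intro mult_right_mono) (simp_all only: of_int_le_iff less_imp_le)
    moreover have "of_int e * d \<le> of_int e * F" using b d_range by (intro mult_left_mono) auto
    ultimately have "f j \<le> real (kappa I j) * F * of_int x" by (simp add: f_def xec algebra_simps)
    moreover have "x = 0 \<or> x = 1" using b by auto
    ultimately show ?thesis using lo xec by auto
  qed
  ultimately show ?thesis
    unfolding instance_feasible_def feasible_set_def
    by (auto simp: solution_def upper_cap_def lower_cap_def f_def)
qed

text \<open>This is where the structure of optimal flows enters: \<open>integral_flow\<close> replaces the flow of an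
  arbitrary feasible point, for the same \<open>x\<close>, by a selection that is at most as expensive.\<close>

lemma feasible_admissible:
  assumes "(x, f) \<in> instance_feasible I"
  shows "\<exists>os. admissible os \<and> (\<Sum>j=1..n. ratio j (os j)) \<le> of_int sg * instance_objective I (x, f)"
proof -
  from assms have x: "\<And>j. 1 \<le> j \<Longrightarrow> j \<le> n \<Longrightarrow> x j = 0 \<or> x j = 1"
    and fsum: "(\<Sum>j=0..n. f j) = d" and cap: "\<And>j. j \<le> n \<Longrightarrow>
      lower_cap (kappa I) F j * (x(0 := 1)) j \<le> f j \<and> f j \<le> upper_cap (kappa I) F j * (x(0 := 1)) j"
    by (auto simp: instance_feasible_def feasible_set_def PiE_iff)
  have f0: "f 0 = 0" using cap[of 0] by (simp add: upper_cap_def lower_cap_def)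
  \<comment> \<open>the entries of \<open>x\<close> as integers\<close>
  define y :: "nat \<Rightarrow> int" where "y j = (if x j = 1 then 1 else 0)" for j
  have y: "of_int (y j) = x j" "y j = 0 \<or> y j = 1" if "1 \<le> j" "j \<le> n" for j
    using x[OF that] by (auto simp: y_def)
  define K where "K j = int (kappa I j) * y j" for j
  define b where "b j = of_int sg * (of_rat (coeff_f I j) :: real)" for j
  have fK: "\<bar>f j\<bar> \<le> of_int (K j) * F" if "j \<in> {1..n}" for j
    using cap[of j] that y(1)[of j]
    by (simp add: upper_cap_def lower_cap_def K_def abs_le_iff mult.assoc mult.commute mult.left_commute)
  have "sum f {1..n} = d" using fsum f0 by (simp add: sum_from_0)
  from integral_flow[OF _ F_pos d_range fK this, of b] obtain c e where
    ce: "\<And>j. j \<in> {1..n} \<Longrightarrow> 0 \<le> e j \<and> e j \<le> 1 \<and> - K j \<le> c j \<and> c j \<le> K j - e j"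
    and sums: "sum c {1..n} = 0" "sum e {1..n} = (if d = 0 then 0 else 1)"
    and cost: "(\<Sum>j\<in>{1..n}. b j * (of_int (c j) * F + of_int (e j) * d)) \<le> (\<Sum>j\<in>{1..n}. b j * f j)"
    by blast
  define os where "os j = (y j, e j, c j)" for j
  have opt: "os j \<in> Opt j" if "1 \<le> j" "j \<le> n" for j
  proof -
    have "e j \<le> y j" using ce[of j] that y(2)[OF that] by (auto simp: K_def)
    then show ?thesis using ce[of j] that y(2)[OF that] by (auto simp: os_def Opt_def K_def)
  qed
  have adm: "admissible os"
    using weight_sum[of os] opt sums by (simp add: admissible_def os_def)
  have "(\<Sum>j=1..n. ratio j (os j)) =
      (\<Sum>j=1..n. of_int sg * (of_rat (coeff_x I j) * x j) + b j * (of_int (c j) * F + of_int (e j) * d))"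
    by (rule sum.cong) (simp_all add: os_def ratio_real b_def y(1) algebra_simps)
  also have "\<dots> \<le> (\<Sum>j=1..n. of_int sg * (of_rat (coeff_x I j) * x j)) + (\<Sum>j=1..n. b j * f j)"
    using cost by (simp add: sum.distrib)
  also have "\<dots> = of_int sg * instance_objective I (x, f)"
    by (simp add: instance_objective_def linear_objective_def sum_from_0 f0 b_def sum_distrib_left
        distrib_left mult.assoc)
  finally show ?thesis using adm by blast
qed

lemma solution_optimal:
  assumes "admissible os" "\<And>os'. admissible os' \<Longrightarrow> (\<Sum>i=1..n. ratio i (os i)) \<le> (\<Sum>i=1..n. ratio i (os' i))"
  shows "is_optimal sense (instance_objective I) (instance_feasible I) (solution os)"
proof -
  have "of_int sg * instance_objective I (solution os) \<le> of_int sg * instance_objective I y"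
    if "y \<in> instance_feasible I" for y
    using feasible_admissible[of "fst y" "snd y"] that assms(2) unfolding objective_ratio
    by fastforce
  then show ?thesis
    using admissible_feasible[OF assms(1)]
    by (cases sense) (auto simp: is_optimal_def is_arg_min_def is_arg_max_def sgn_of_def not_less)
qed

text \<open>What remains is to read the output array as the prescribed list.\<close>

lemma answer_optimal_output:
  assumes A: "answer (s ''out'')"
  shows "optimal_output sense I (output_of s)"
proof (cases "instance_feasible I = {}")
  case True
  then have "\<not> (\<exists>os. admissible os)" using admissible_feasible by blast
  then have "s ''out'' 0 = 1" "s ''out'' 1 = 0" using A by (simp_all add: answer_def)
  then show ?thesis using True by (simp add: optimal_output_def output_of_def)
next
  case False
  then obtain x f where "(x, f) \<in> instance_feasible I" by auto
  then have "\<exists>os. admissible os" using feasible_admissible by blast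
  then obtain os where adm: "admissible os"
    and opt: "\<And>os'. admissible os' \<Longrightarrow> (\<Sum>i=1..n. ratio i (os i)) \<le> (\<Sum>i=1..n. ratio i (os' i))"
    and head: "header (s ''out'')" and E: "\<And>j. 1 \<le> j \<Longrightarrow> j \<le> n \<Longrightarrow> entry (s ''out'') j (os j)"
    using A by (auto simp: answer_def)
  let ?o = "s ''out''"
  define X where "X j = ?o (1 + int j)" for j
  define P where "P j = ?o (int n + 2 + 2 * int j)" for j
  define Q where "Q j = ?o (int n + 3 + 2 * int j)" for j
  \<comment> \<open>reading consecutive cells in pairs\<close>
  have pairs: "concat (map (\<lambda>j. [?o (int (a + 2 * j)), ?o (int (a + 2 * j + 1))]) [0..<k]) =
      map (\<lambda>i. ?o (int i)) [a..<a + 2 * k]" for a k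
    by (induction k) (auto simp: add.commute add.left_commute)
  have "Suc (nat (?o 0)) = 3 * n + 4" using head by (simp add: header_def)
  then have "output_of s = map (\<lambda>i. ?o (int i)) [1..<3 * n + 4]" unfolding output_of_def by (rule arg_cong)
  also have "[1..<3 * n + 4] = [1] @ [2..<n + 2] @ [n + 2..<n + 2 + 2 * Suc n]"
  proof -
    have 1: "3 * n + 4 = (n + 2) + 2 * Suc n" by simp
    have 2: "[1..<n + 2] = [1] @ [2..<n + 2]" by (simp add: upt_conv_Cons numeral_2_eq_2)
    show ?thesis
      unfolding 1 append_assoc[symmetric] 2[symmetric] by (rule upt_add_eq_append) simp
  qed
  also have "[2..<n + 2] = map Suc [1..<Suc n]" by (simp add: map_Suc_upt numeral_2_eq_2)
  finally have "output_of s = [1] @ map X [1..<Suc n] @ map (\<lambda>i. ?o (int i)) [n + 2..<n + 2 + 2 * Suc n]"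
    using head by (simp add: X_def header_def del: upt_Suc)
  also have "map (\<lambda>i. ?o (int i)) [n + 2..<n + 2 + 2 * Suc n] = concat (map (\<lambda>j. [P j, Q j]) [0..<Suc n])"
    unfolding pairs[symmetric] by (simp add: P_def Q_def algebra_simps del: upt_Suc)
  finally have out: "output_of s = [1] @ map X [1..<Suc n] @ concat (map (\<lambda>j. [P j, Q j]) [0..<Suc n])" .
  have vals: "X j = fst (os j)" "P j = flow_num (fst (snd (os j))) (snd (snd (os j)))"
    "Q j = snd (quotient_of (fbar I)) * snd (quotient_of (demand I))" if "1 \<le> j" "j \<le> n" for j
    using E[OF that] by (auto simp: entry_def X_def P_def Q_def split: prod.splits)
  have vals0: "P 0 = 0" "Q 0 = 1" using head by (simp_all add: P_def Q_def header_def)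
  have pos: "Q j > 0" if "j \<in> {0..n}" for j
    using vals(3)[of j] vals0 that quotient_of_denom_pos' by (cases "j = 0") auto
  have "(\<lambda>j\<in>{1..n}. real_of_int (X j), \<lambda>j\<in>{0..n}. real_of_int (P j) / real_of_int (Q j)) = solution os"
    unfolding solution_def prod.inject
  proof (intro conjI restrict_ext)
    show "real_of_int (X j) = real_of_int (fst (os j))" if "j \<in> {1..n}" for j
      using vals that by simp
    show "real_of_int (P j) / real_of_int (Q j) =
      (if j = 0 then 0 else of_int (snd (snd (os j))) * F + of_int (fst (snd (os j))) * d)" if "j \<in> {0..n}" for j
    proof (cases "j = 0")
      case False
      then show ?thesis using that vals(2,3)[of j] flow_real[of "fst (snd (os j))" "snd (snd (os j))"] by simp
    qed (simp add: vals0)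
  qed
  then have "is_optimal sense (instance_objective I) (instance_feasible I)
      (\<lambda>j\<in>{1..n}. real_of_int (X j), \<lambda>j\<in>{0..n}. real_of_int (P j) / real_of_int (Q j))"
    using solution_optimal[OF adm opt] by simp
  with out pos show ?thesis
    unfolding optimal_output_def if_not_P[OF False]
    by (intro exI[of _ X] exI[of _ P] exI[of _ Q] conjI ballI)
qed

lemma solves_instance:
  "\<exists>t s. exec (flow_prog kbar sg) (initial_store (encode_instance I)) t s \<and>
     t \<le> time_bound kbar sg (bit_size (encode_instance I)) \<and> optimal_output sense I (output_of s)"
proof -
  have "n \<le> length (encode_instance I)" unfolding encode_layout(1) by simp
  then have "n \<le> bit_size (encode_instance I)" using length_le_bit_size order_trans by blast
  note time = flow_time[OF this]
  have start: "start_store = initial_store (encode_instance I)"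
    unfolding start_store_def by (auto simp: initial_store_def fun_eq_iff)
  from flow_prog_correct obtain t s where
    "exec (flow_prog kbar sg) start_store t s" "t \<le> flow_steps * (coef (flow_prog kbar sg) * (m + 2))"
    "answer (s ''out'')"
    by blast
  then show ?thesis
    unfolding start using time answer_optimal_output order_trans by blast
qed

end

theorem theorem1:
  fixes kbar :: nat and sense :: sense
  assumes "kbar > 0"
  shows "poly_time_solvable (flow_instances kbar) encode_instance (optimal_output sense)"
proof -
  obtain p where p: "\<forall>L. time_bound kbar (sgn_of sense) L = poly p L" using time_bound_poly by blast
  have "\<exists>t s. exec (flow_prog kbar (sgn_of sense)) (initial_store (encode_instance I)) t s \<and>
      t \<le> poly p (bit_size (encode_instance I)) \<and> optimal_output sense I (output_of s)"
    if "I \<in> flow_instances kbar" for I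
  proof -
    interpret encoded_instance kbar I sense by standard fact
    show ?thesis using solves_instance p by simp
  qed
  then show ?thesis unfolding poly_time_solvable_def by blast
qed

end
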